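(* Suppose that $E^*$ has the Radon–Nikodym property. If a uniformly integrable sequence $(f_k)$ in $\mathcal L^1_E$ converges scalarly in measure to $f_0\in\mathcal L^1_E$, then $(f_k)$ also converges limitedly to $f_0$.
   Context: $(E,\|\cdot\|)$ is a Banach space with dual $E^*$, and $(\Omega,\mathcal F,\mu)$ is a probability space. $\mathcal L^1_E$ is the (prequotient) space of Bochner $\mu$-integrable functions $f:\Omega\to E$. A subset $K\subset\mathcal L^1_E$ is uniformly integrable if $\lim_{c\to\infty}\sup_{f\in K}\int_{\{\|f\|\ge c\}}\|f\|\,d\mu=0$. A sequence $(f_k)$ in $\mathcal L^1_E$ converges scalarly in measure to $f_0$ if for each $x^*\in E^*$ the real sequence $(x^*(f_k))_k$ converges in measure to $x^*(f_0)$. Let $\mathcal G$ be the collection of all functions $g:\Omega\times E\to\mathbb R$ such that: (i) $g(\omega,0)=0$ for each $\omega\in\Omega$; (ii) $g(\omega,\cdot)$ is weakly, i.e. $\sigma(E,E^* )$-, continuous for each $\omega\in\Omega$; (iii) there exist $C>0$ and $\phi\in\mathcal L^1_{\mathbb R}$ with $|g(\omega,x)|\le C\|x\|+\phi(\omega)$ for all $\omega\in\Omega$, $x\in E$; (iv) $g(\cdot,f(\cdot))$ is $\mathcal F$-measurable for each $f\in\mathcal L^1_E$. A sequence $(f_k)$ in $\mathcal L^1_E$ converges limitedly to $f_0\in\mathcal L^1_E$ if $\lim_k\int_\Omega g(\omega,f_k(\omega)-f_0(\omega))\,d\mu(\omega)=0$ for each $g\in\mathcal G$. *)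

theory Defs
  imports "HOL-Probability.Probability"
begin

section \<open>Bochner integration in arbitrary Banach spaces\<close>

text \<open>
  The library predicate \<open>has_bochner_integral\<close> is restricted to second countable (that is,
  separable) codomains. Here the codomain is an arbitrary Banach space, and Borel measurability is
  replaced by strong measurability, i.e. pointwise approximability by simple functions. The
  approximation is required at every point of the space and not just almost everywhere, so that
  strongly measurable functions are measurable with respect to the given \<open>\<sigma>\<close>-algebra, which need
  not be complete. The integral is the limit of the integrals of simple functions.
\<close>

definition strongly_measurable :: "'a measure \<Rightarrow> ('a \<Rightarrow> 'b::real_normed_vector) \<Rightarrow> bool" where
  "strongly_measurable M f \<longleftrightarrow>
     (\<exists>s. (\<forall>i::nat. simple_function M (s i)) \<and> (\<forall>\<omega>\<in>space M. (\<lambda>i. s i \<omega>) \<longlonglongrightarrow> f \<omega>))"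

definition has_strong_bochner_integral ::
    "'a measure \<Rightarrow> ('a \<Rightarrow> 'b::real_normed_vector) \<Rightarrow> 'b \<Rightarrow> bool" where
  "has_strong_bochner_integral M f x \<longleftrightarrow>
     strongly_measurable M f \<and>
     (\<exists>s. (\<forall>i::nat. Bochner_Integration.simple_bochner_integrable M (s i)) \<and>
          (\<lambda>i. \<integral>\<^sup>+\<omega>. ennreal (norm (f \<omega> - s i \<omega>)) \<partial>M) \<longlonglongrightarrow> 0 \<and>
          (\<lambda>i. Bochner_Integration.simple_bochner_integral M (s i)) \<longlonglongrightarrow> x)"

text \<open>The space \<open>\<L>\<^sup>1\<close> before passing to the quotient by almost everywhere equality.\<close>

definition bochner_L1 :: "'a measure \<Rightarrow> ('a \<Rightarrow> 'b::real_normed_vector) set" where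
  "bochner_L1 M = {f. \<exists>x. has_strong_bochner_integral M f x}"

section \<open>The Radon--Nikodym property\<close>

definition vector_measure :: "'a measure \<Rightarrow> ('a set \<Rightarrow> 'b::real_normed_vector) \<Rightarrow> bool" where
  "vector_measure M G \<longleftrightarrow>
     (\<forall>A::nat \<Rightarrow> 'a set. range A \<subseteq> sets M \<longrightarrow> disjoint_family A \<longrightarrow>
        (\<lambda>n. G (A n)) sums G (\<Union>n. A n))"

definition finite_variation :: "'a measure \<Rightarrow> ('a set \<Rightarrow> 'b::real_normed_vector) \<Rightarrow> bool" where
  "finite_variation M G \<longleftrightarrow>
     (\<exists>B::real. \<forall>P. finite P \<longrightarrow> P \<subseteq> sets M \<longrightarrow> disjoint P \<longrightarrow> (\<Sum>A\<in>P. norm (G A)) \<le> B)"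

definition radon_nikodym_property_wrt :: "'a measure \<Rightarrow> 'b::banach itself \<Rightarrow> bool" where
  "radon_nikodym_property_wrt M _ \<longleftrightarrow>
     (\<forall>G::'a set \<Rightarrow> 'b.
        vector_measure M G \<longrightarrow> finite_variation M G \<longrightarrow> (\<forall>A\<in>null_sets M. G A = 0) \<longrightarrow>
        (\<exists>h\<in>bochner_L1 M.
           \<forall>A\<in>sets M. has_strong_bochner_integral M (\<lambda>\<omega>. indicator A \<omega> *\<^sub>R h \<omega>) (G A)))"

text \<open>
  One cannot quantify over the finite measure spaces on all types at once, so the quantifier ranges
  over all finite measure spaces, with arbitrary \<open>\<sigma>\<close>-algebras, whose points are real numbers.
  These include Lebesgue measure on the unit interval, for which the property is already equivalent
  to the property for all finite measure spaces whatsoever.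
\<close>

definition radon_nikodym_property :: "'b::banach itself \<Rightarrow> bool" where
  "radon_nikodym_property X \<longleftrightarrow>
     (\<forall>M::real measure. finite_measure M \<longrightarrow> radon_nikodym_property_wrt M X)"

section \<open>Modes of convergence\<close>

text \<open>The supremum is taken in \<open>[0,\<infinity>]\<close>, as it may be infinite for small \<open>c\<close>.\<close>

definition uniformly_integrable :: "'a measure \<Rightarrow> ('a \<Rightarrow> 'b::real_normed_vector) set \<Rightarrow> bool" where
  "uniformly_integrable M K \<longleftrightarrow>
     ((\<lambda>c::real. SUP f\<in>K. \<integral>\<^sup>+\<omega>\<in>{\<omega>\<in>space M. c \<le> norm (f \<omega>)}. ennreal (norm (f \<omega>)) \<partial>M)
        \<longlongrightarrow> 0) at_top"

definition converges_in_measure :: "'a measure \<Rightarrow> (nat \<Rightarrow> 'a \<Rightarrow> real) \<Rightarrow> ('a \<Rightarrow> real) \<Rightarrow> bool" where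
  "converges_in_measure M u v \<longleftrightarrow>
     (\<forall>\<epsilon>>0. (\<lambda>k. measure M {\<omega>\<in>space M. \<epsilon> \<le> \<bar>u k \<omega> - v \<omega>\<bar>}) \<longlonglongrightarrow> 0)"

definition converges_scalarly_in_measure ::
    "'a measure \<Rightarrow> (nat \<Rightarrow> 'a \<Rightarrow> 'b::real_normed_vector) \<Rightarrow> ('a \<Rightarrow> 'b) \<Rightarrow> bool" where
  "converges_scalarly_in_measure M f f0 \<longleftrightarrow>
     (\<forall>\<phi>::'b \<Rightarrow>\<^sub>L real. converges_in_measure M (\<lambda>k \<omega>. blinfun_apply \<phi> (f k \<omega>)) (\<lambda>\<omega>. blinfun_apply \<phi> (f0 \<omega>)))"

text \<open>
  The coarsest topology making every continuous linear functional continuous: \<open>euclidean\<close> on the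
  function space is the product topology.
\<close>

definition weak_topology :: "'b::real_normed_vector topology" where
  "weak_topology = pullback_topology UNIV (\<lambda>x (\<phi>::'b \<Rightarrow>\<^sub>L real). blinfun_apply \<phi> x) euclidean"

definition limited_integrands :: "'a measure \<Rightarrow> ('a \<Rightarrow> 'b::real_normed_vector \<Rightarrow> real) set" where
  "limited_integrands M =
     {g. (\<forall>\<omega>\<in>space M. g \<omega> 0 = 0) \<and>
         (\<forall>\<omega>\<in>space M. continuous_map weak_topology euclideanreal (g \<omega>)) \<and>
         (\<exists>C>0. \<exists>\<phi>::'a \<Rightarrow> real. integrable M \<phi> \<and>
            (\<forall>\<omega>\<in>space M. \<forall>x. \<bar>g \<omega> x\<bar> \<le> C * norm x + \<phi> \<omega>)) \<and>
         (\<forall>f\<in>bochner_L1 M. (\<lambda>\<omega>. g \<omega> (f \<omega>)) \<in> borel_measurable M)}"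

definition converges_limitedly ::
    "'a measure \<Rightarrow> (nat \<Rightarrow> 'a \<Rightarrow> 'b::real_normed_vector) \<Rightarrow> ('a \<Rightarrow> 'b) \<Rightarrow> bool" where
  "converges_limitedly M f f0 \<longleftrightarrow>
     (\<forall>g\<in>limited_integrands M. (\<lambda>k. \<integral>\<omega>. g \<omega> (f k \<omega> - f0 \<omega>) \<partial>M) \<longlonglongrightarrow> 0)"

end

theory Submission
  imports Defs
begin

text \<open>
  All functions involved take values in the closure of one countable set \<open>D\<close>. By Stegall's argument,
  the Radon--Nikodym property makes \<open>E\<^sup>*\<close>, restricted to \<open>D\<close>, norm separable: otherwise a
  weak* Cantor scheme in a ball of \<open>E\<^sup>*\<close>, indexed by the dyadic intervals of \<open>[0,1)\<close>, has branches
  that are uniformly separated in norm; the density of the vector measure which the scheme defines on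
  \<open>[0,1)\<close> agrees almost everywhere with the branches on \<open>D\<close> and yet has a separable range, so
  almost all of \<open>[0,1)\<close> would be countable. Hence countably many functionals control weak
  convergence of bounded sequences in the closure of \<open>D\<close>. Along a subsequence,
  convergence in measure for these becomes weak convergence almost everywhere, dominated
  convergence handles the part where the functions are bounded, and uniform integrability the rest.
\<close>

section \<open>Strong Bochner integration\<close>

text \<open>The countable set collects the finitely many values of each approximating simple
  function. It stands in for separability of the codomain, both for the given sequence and for
  Radon-Nikodym densities.\<close>

lemma strongly_measurable_range_separable:
  assumes "strongly_measurable M f"
  obtains C where "countable C" "f ` space M \<subseteq> closure C"
proof -
  obtain s where s: "\<And>i::nat. simple_function M (s i)" "\<And>\<omega>. \<omega> \<in> space M \<Longrightarrow> (\<lambda>i. s i \<omega>) \<longlonglongrightarrow> f \<omega>"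
    using assms by (auto simp: strongly_measurable_def)
  show thesis
  proof
    show "countable (\<Union>i. s i ` space M)"
      using simple_functionD(1)[OF s(1)] by (simp add: countable_finite)
    show "f ` space M \<subseteq> closure (\<Union>i. s i ` space M)"
    proof safe
      fix \<omega> assume "\<omega> \<in> space M"
      then show "f \<omega> \<in> closure (\<Union>i. s i ` space M)"
        using s(2)[of \<omega>] unfolding closure_sequential
        by (intro exI[of _ "\<lambda>i. s i \<omega>"]) auto
    qed
  qed
qed

text \<open>Composing a simple function with any \<open>T\<close> gives a measurable function, and
  continuity carries the limit over. Norms and functionals of strongly measurable functions thereby
  become Borel measurable.\<close>

lemma strongly_measurable_continuous_compose:
  fixes T :: "'b::real_normed_vector \<Rightarrow> 'c::metric_space"
  assumes "strongly_measurable M f" "continuous_on UNIV T"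
  shows "(\<lambda>\<omega>. T (f \<omega>)) \<in> borel_measurable M"
proof -
  obtain s where s: "\<And>i::nat. simple_function M (s i)" "\<And>\<omega>. \<omega> \<in> space M \<Longrightarrow> (\<lambda>i. s i \<omega>) \<longlonglongrightarrow> f \<omega>"
    using assms(1) by (auto simp: strongly_measurable_def)
  show ?thesis
  proof (rule borel_measurable_LIMSEQ_metric)
    show "(\<lambda>\<omega>. T (s i \<omega>)) \<in> borel_measurable M" for i
      by (rule borel_measurable_simple_function[OF simple_function_compose1[OF s(1), of T]])
    show "(\<lambda>i. T (s i \<omega>)) \<longlonglongrightarrow> T (f \<omega>)" if "\<omega> \<in> space M" for \<omega>
      using continuous_on_tendsto_compose[OF assms(2) s(2)[OF that]] by auto
  qed
qed

lemma strongly_measurable_diff: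
  assumes "strongly_measurable M f" "strongly_measurable M g"
  shows "strongly_measurable M (\<lambda>\<omega>. f \<omega> - g \<omega>)"
proof -
  from assms(1) obtain s where s: "\<And>i::nat. simple_function M (s i)" "\<And>\<omega>. \<omega> \<in> space M \<Longrightarrow> (\<lambda>i. s i \<omega>) \<longlonglongrightarrow> f \<omega>"
    by (auto simp: strongly_measurable_def)
  from assms(2) obtain t where t: "\<And>i::nat. simple_function M (t i)" "\<And>\<omega>. \<omega> \<in> space M \<Longrightarrow> (\<lambda>i. t i \<omega>) \<longlonglongrightarrow> g \<omega>"
    by (auto simp: strongly_measurable_def)
  from s t show ?thesis
    unfolding strongly_measurable_def
    by (intro exI[of _ "\<lambda>i \<omega>. s i \<omega> - t i \<omega>"])
       (auto intro: simple_function_compose2[where h = "(-)"] tendsto_diff)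
qed

lemma strongly_measurable_simple:
  "Bochner_Integration.simple_bochner_integrable M s \<Longrightarrow> strongly_measurable M s"
  unfolding strongly_measurable_def
  by (intro exI[of _ "\<lambda>_. s"]) (auto elim: Bochner_Integration.simple_bochner_integrable.cases)

lemma bochner_L1_strongly_measurable: "f \<in> bochner_L1 M \<Longrightarrow> strongly_measurable M f"
  by (auto simp: bochner_L1_def has_strong_bochner_integral_def)

section \<open>Differences, linear images and norms under the strong Bochner integral\<close>

lemma has_strong_bochner_integral_diff:
  fixes f g :: "'a \<Rightarrow> 'b::real_normed_vector"
  assumes "has_strong_bochner_integral M f x" "has_strong_bochner_integral M g y"
  shows "has_strong_bochner_integral M (\<lambda>\<omega>. f \<omega> - g \<omega>) (x - y)"
proof -
  from assms(1) obtain s where f: "strongly_measurable M f"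
    and s: "\<And>i::nat. Bochner_Integration.simple_bochner_integrable M (s i)"
      "(\<lambda>i. \<integral>\<^sup>+\<omega>. ennreal (norm (f \<omega> - s i \<omega>)) \<partial>M) \<longlonglongrightarrow> 0"
      "(\<lambda>i. Bochner_Integration.simple_bochner_integral M (s i)) \<longlonglongrightarrow> x"
    by (auto simp: has_strong_bochner_integral_def)
  from assms(2) obtain t where g: "strongly_measurable M g"
    and t: "\<And>i::nat. Bochner_Integration.simple_bochner_integrable M (t i)"
      "(\<lambda>i. \<integral>\<^sup>+\<omega>. ennreal (norm (g \<omega> - t i \<omega>)) \<partial>M) \<longlonglongrightarrow> 0"
      "(\<lambda>i. Bochner_Integration.simple_bochner_integral M (t i)) \<longlonglongrightarrow> y"
    by (auto simp: has_strong_bochner_integral_def)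
  have [measurable]: "(\<lambda>\<omega>. norm (f \<omega> - s i \<omega>)) \<in> borel_measurable M"
    "(\<lambda>\<omega>. norm (g \<omega> - t i \<omega>)) \<in> borel_measurable M" for i
    by (intro strongly_measurable_continuous_compose[where T = norm] strongly_measurable_diff
        strongly_measurable_simple f g s t continuous_intros)+
  have *: "norm ((a - b) - (c - d)) \<le> norm (a - c) + norm (b - d)" for a b c d :: 'b
    using norm_triangle_ineq4[of "a - c" "b - d"] by (simp add: algebra_simps)
  have "(\<integral>\<^sup>+\<omega>. ennreal (norm ((f \<omega> - g \<omega>) - (s i \<omega> - t i \<omega>))) \<partial>M)
      \<le> (\<integral>\<^sup>+\<omega>. ennreal (norm (f \<omega> - s i \<omega>)) \<partial>M) + (\<integral>\<^sup>+\<omega>. ennreal (norm (g \<omega> - t i \<omega>)) \<partial>M)" for i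
    by (subst nn_integral_add[symmetric])
       (auto intro!: nn_integral_mono * simp flip: ennreal_plus)
  moreover have "(\<lambda>i. (\<integral>\<^sup>+\<omega>. ennreal (norm (f \<omega> - s i \<omega>)) \<partial>M)
      + (\<integral>\<^sup>+\<omega>. ennreal (norm (g \<omega> - t i \<omega>)) \<partial>M)) \<longlonglongrightarrow> 0"
    using tendsto_add[OF s(2) t(2)] by simp
  ultimately have "(\<lambda>i. \<integral>\<^sup>+\<omega>. ennreal (norm ((f \<omega> - g \<omega>) - (s i \<omega> - t i \<omega>))) \<partial>M) \<longlonglongrightarrow> 0"
    by (rule_tac tendsto_sandwich[where f = "\<lambda>_. 0"]) auto
  moreover have "(\<lambda>i. Bochner_Integration.simple_bochner_integral M (\<lambda>\<omega>. s i \<omega> - t i \<omega>)) \<longlonglongrightarrow> x - y"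
    by (simp add: Bochner_Integration.simple_bochner_integral_diff s(1) t(1) tendsto_diff[OF s(3) t(3)])
  moreover have "Bochner_Integration.simple_bochner_integrable M (\<lambda>\<omega>. s i \<omega> - t i \<omega>)" for i
    by (intro Bochner_Integration.simple_bochner_integrable_compose2[where p = "(-)"] s t) auto
  ultimately show ?thesis
    unfolding has_strong_bochner_integral_def using strongly_measurable_diff[OF f g]
    by (intro conjI exI[of _ "\<lambda>i \<omega>. s i \<omega> - t i \<omega>"]) auto
qed

lemma bochner_L1_diff:
  "f \<in> bochner_L1 M \<Longrightarrow> g \<in> bochner_L1 M \<Longrightarrow> (\<lambda>\<omega>. f \<omega> - g \<omega>) \<in> bochner_L1 M"
  unfolding bochner_L1_def using has_strong_bochner_integral_diff by blast

text \<open>The images of the approximating simple functions approximate the image, with errors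
  enlarged by at most the factor \<open>K\<close>. With \<open>T\<close> the evaluation at a vector,
  equations between vector integrals become equations between real ones.\<close>

lemma has_strong_bochner_integral_bounded_linear:
  fixes T :: "'b::real_normed_vector \<Rightarrow> 'c::{real_normed_vector, second_countable_topology}"
  assumes "has_strong_bochner_integral M f x" and T: "bounded_linear T"
  shows "has_bochner_integral M (\<lambda>\<omega>. T (f \<omega>)) (T x)"
proof -
  interpret bounded_linear T by fact
  obtain K where K: "\<And>y. norm (T y) \<le> norm y * K" "K > 0"
    using pos_bounded by blast
  from assms(1) obtain s where f: "strongly_measurable M f"
    and s: "\<And>i::nat. Bochner_Integration.simple_bochner_integrable M (s i)"
      "(\<lambda>i. \<integral>\<^sup>+\<omega>. ennreal (norm (f \<omega> - s i \<omega>)) \<partial>M) \<longlonglongrightarrow> 0"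
      "(\<lambda>i. Bochner_Integration.simple_bochner_integral M (s i)) \<longlonglongrightarrow> x"
    by (auto simp: has_strong_bochner_integral_def)
  have [measurable]: "(\<lambda>\<omega>. norm (f \<omega> - s i \<omega>)) \<in> borel_measurable M" for i
    by (intro strongly_measurable_continuous_compose[where T = norm] strongly_measurable_diff
        strongly_measurable_simple f s continuous_intros)
  show ?thesis
  proof (rule has_bochner_integral.intros)
    show "(\<lambda>\<omega>. T (f \<omega>)) \<in> borel_measurable M"
      by (intro strongly_measurable_continuous_compose f linear_continuous_on T)
    show "Bochner_Integration.simple_bochner_integrable M (\<lambda>\<omega>. T (s i \<omega>))" for i
      by (rule Bochner_Integration.simple_bochner_integrable_compose2[where p = "\<lambda>a b. T a", OF _ s(1) s(1)])
         (simp add: zero)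
    have "(\<integral>\<^sup>+\<omega>. ennreal (norm (T (f \<omega>) - T (s i \<omega>))) \<partial>M)
        \<le> ennreal K * (\<integral>\<^sup>+\<omega>. ennreal (norm (f \<omega> - s i \<omega>)) \<partial>M)" for i
      using K by (subst nn_integral_cmult[symmetric])
        (auto intro!: nn_integral_mono simp: mult.commute simp flip: diff ennreal_mult)
    moreover have "(\<lambda>i. ennreal K * (\<integral>\<^sup>+\<omega>. ennreal (norm (f \<omega> - s i \<omega>)) \<partial>M)) \<longlonglongrightarrow> 0"
      using ennreal_tendsto_cmult[OF _ s(2), of "ennreal K"] by simp
    ultimately show "(\<lambda>i. \<integral>\<^sup>+\<omega>. ennreal (norm (T (f \<omega>) - T (s i \<omega>))) \<partial>M) \<longlonglongrightarrow> 0"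
      by (rule_tac tendsto_sandwich[where f = "\<lambda>_. 0"]) auto
    show "(\<lambda>i. Bochner_Integration.simple_bochner_integral M (\<lambda>\<omega>. T (s i \<omega>))) \<longlonglongrightarrow> T x"
      unfolding Bochner_Integration.simple_bochner_integral_linear[OF linear s(1)]
      by (rule tendsto[OF s(3)])
  qed
qed

lemma bochner_L1_integrable_norm:
  assumes "f \<in> bochner_L1 M"
  shows "integrable M (\<lambda>\<omega>. norm (f \<omega>))"
proof -
  from assms obtain x s where f: "strongly_measurable M f"
    and s: "\<And>i::nat. Bochner_Integration.simple_bochner_integrable M (s i)"
      "(\<lambda>i. \<integral>\<^sup>+\<omega>. ennreal (norm (f \<omega> - s i \<omega>)) \<partial>M) \<longlonglongrightarrow> 0"
    by (auto simp: bochner_L1_def has_strong_bochner_integral_def)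
  have [measurable]: "(\<lambda>\<omega>. norm (f \<omega> - s i \<omega>)) \<in> borel_measurable M"
      "(\<lambda>\<omega>. norm (f \<omega>)) \<in> borel_measurable M" "(\<lambda>\<omega>. norm (s i \<omega>)) \<in> borel_measurable M" for i
    by (intro strongly_measurable_continuous_compose[where T = norm] strongly_measurable_diff
        strongly_measurable_simple f s continuous_intros)+
  \<comment> \<open>A single approximant at L1 distance below 1 suffices: the norm of
    \<open>f\<close> is at most the error plus the norm of a simple function.\<close>
  have "eventually (\<lambda>i. (\<integral>\<^sup>+\<omega>. ennreal (norm (f \<omega> - s i \<omega>)) \<partial>M) < 1) sequentially"
    using s(2) by (rule order_tendstoD) simp
  then obtain i where i: "(\<integral>\<^sup>+\<omega>. ennreal (norm (f \<omega> - s i \<omega>)) \<partial>M) < 1"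
    using eventually_happens'[OF sequentially_bot] by blast
  have "Bochner_Integration.simple_bochner_integrable M (\<lambda>\<omega>. norm (s i \<omega>))"
    by (rule Bochner_Integration.simple_bochner_integrable_compose2[where p = "\<lambda>a b. norm a", OF _ s(1) s(1)]) simp
  then have "integrable M (\<lambda>\<omega>. norm (s i \<omega>))"
    using has_bochner_integral_simple_bochner_integrable integrable.intros by blast
  then have si: "(\<integral>\<^sup>+\<omega>. ennreal (norm (s i \<omega>)) \<partial>M) < \<infinity>"
    by (simp add: integrable_iff_bounded)
  have "(\<integral>\<^sup>+\<omega>. ennreal (norm (f \<omega>)) \<partial>M)
      \<le> (\<integral>\<^sup>+\<omega>. ennreal (norm (f \<omega> - s i \<omega>)) \<partial>M) + (\<integral>\<^sup>+\<omega>. ennreal (norm (s i \<omega>)) \<partial>M)"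
    by (subst nn_integral_add[symmetric])
       (auto intro!: nn_integral_mono norm_triangle_sub simp: add.commute simp flip: ennreal_plus)
  also have "\<dots> < \<infinity>"
    using si less_trans[OF i ennreal_one_less_top] by simp
  finally show ?thesis
    by (simp add: integrable_iff_bounded)
qed

section \<open>Weak continuity along sequences\<close>

text \<open>The weak topology is pulled back from a product topology, so a weakly open set is the
  trace of a product-open one, and convergence under each functional is convergence in the
  product.\<close>

lemma weakly_continuous_tendsto:
  fixes x :: "nat \<Rightarrow> 'b::real_normed_vector"
  assumes G: "continuous_map weak_topology euclideanreal G"
    and x: "\<And>\<psi>::'b \<Rightarrow>\<^sub>L real. (\<lambda>k. blinfun_apply \<psi> (x k)) \<longlonglongrightarrow> blinfun_apply \<psi> l"
  shows "(\<lambda>k. G (x k)) \<longlonglongrightarrow> G l"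
proof (rule topological_tendstoI)
  fix S assume S: "open S" "G l \<in> S"
  have top: "topspace (weak_topology :: 'b topology) = UNIV"
    by (simp add: weak_topology_def topspace_pullback_topology)
  have "openin weak_topology {y. G y \<in> S}"
    using openin_continuous_map_preimage[OF G, of S] S(1) by (simp add: top)
  then obtain U where U: "open U" "{y. G y \<in> S} = (\<lambda>y (\<phi>::'b \<Rightarrow>\<^sub>L real). blinfun_apply \<phi> y) -` U"
    by (auto simp: weak_topology_def openin_pullback_topology)
  have "((\<lambda>k (\<phi>::'b \<Rightarrow>\<^sub>L real). blinfun_apply \<phi> (x k)) \<longlongrightarrow> (\<lambda>\<phi>. blinfun_apply \<phi> l)) sequentially"
    using x unfolding limitin_canonical_iff[symmetric] euclidean_product_topology[symmetric]
    by (simp add: limitin_componentwise)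
  then have "eventually (\<lambda>k. (\<lambda>(\<phi>::'b \<Rightarrow>\<^sub>L real). blinfun_apply \<phi> (x k)) \<in> U) sequentially"
    using topological_tendstoD[OF _ U(1)] U(2) S(2) by blast
  then show "eventually (\<lambda>k. G (x k) \<in> S) sequentially"
    by eventually_elim (use U(2) in blast)
qed

section \<open>Norm separability of the dual on separable sets\<close>

text \<open>Tychonoff's theorem puts the sequence in a compact product of intervals, so it has a
  cluster point. The index type may be uncountable and the product not sequentially compact, hence a
  finer filter instead of a subsequence.\<close>

lemma pointwise_bounded_convergent_subfilter:
  fixes u :: "nat \<Rightarrow> 'i \<Rightarrow> real"
  assumes b: "\<And>n i. \<bar>u n i\<bar> \<le> b i"
  obtains l F where "F \<noteq> bot" "F \<le> sequentially" "\<And>i. ((\<lambda>n. u n i) \<longlongrightarrow> l i) F"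
proof -
  let ?K = "PiE UNIV (\<lambda>i. {- b i .. b i})"
  have "compactin (product_topology (\<lambda>i. euclidean) UNIV) ?K"
    by (subst compactin_PiE) auto
  then have K: "compact ?K"
    by (simp add: euclidean_product_topology)
  have "u n \<in> ?K" for n
    using b[of n] by (auto simp: PiE_iff abs_le_iff minus_le_iff)
  then have "eventually (\<lambda>v. v \<in> ?K) (filtermap u sequentially)"
    by (simp add: eventually_filtermap)
  moreover have "filtermap u sequentially \<noteq> bot"
    by (simp add: filtermap_bot_iff)
  ultimately obtain l where l: "inf (nhds l) (filtermap u sequentially) \<noteq> bot"
    using K unfolding compact_filter by blast
  \<comment> \<open>\<open>F\<close> concentrates on the indices whose terms lie near
    \<open>l\<close>; that \<open>l\<close> is a cluster point keeps it proper.\<close>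
  define F where "F = inf (filtercomap u (nhds l)) sequentially"
  have lim: "(u \<longlongrightarrow> l) F"
    unfolding F_def filterlim_def
    by (meson filtermap_filtercomap filtermap_mono inf_le1 order_trans)
  have "continuous_on UNIV (\<lambda>v :: 'i \<Rightarrow> real. v i)" for i
    by simp
  from continuous_on_tendsto_compose[OF this lim]
  have "((\<lambda>n. u n i) \<longlongrightarrow> l i) F" for i
    by auto
  moreover have "F \<noteq> bot"
  proof
    assume "F = bot"
    then have "eventually (\<lambda>_. False) F" by simp
    then obtain P Q where PQ: "eventually P (nhds l)" "eventually Q sequentially" "\<And>n. P (u n) \<Longrightarrow> Q n \<Longrightarrow> False"
      unfolding F_def eventually_inf eventually_filtercomap by blast
    then have "eventually (\<lambda>y. \<not> P y) (filtermap u sequentially)"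
      unfolding eventually_filtermap by (elim eventually_mono) auto
    with PQ(1) have "eventually (\<lambda>_. False) (inf (nhds l) (filtermap u sequentially))"
      unfolding eventually_inf by blast
    then show False using l by (simp add: trivial_limit_def)
  qed
  ultimately show thesis
    using that[of F l] by (simp add: F_def)
qed

text \<open>Remove from \<open>T\<close> every basic open set whose trace on \<open>T\<close> is countably covered (Cantor--Bendixson).\<close>

lemma condensed_subset:
  fixes T :: "(nat \<Rightarrow> real) set"
  assumes ns: "\<not> (\<exists>C\<subseteq>T. countable C \<and> (\<forall>u\<in>T. \<exists>v\<in>C. \<forall>n. \<bar>u n - v n\<bar> \<le> \<epsilon>))"
  obtains S where "S \<subseteq> T" "S \<noteq> {}"
    "\<And>W. open W \<Longrightarrow> W \<inter> S \<noteq> {} \<Longrightarrow> \<exists>a\<in>W \<inter> S. \<exists>b\<in>W \<inter> S. \<exists>n. \<epsilon> < \<bar>a n - b n\<bar>"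
proof -
  \<comment> \<open>The centers of a cover may lie anywhere in \<open>T\<close>, not just in the
    covered set, so smallness passes to subsets.\<close>
  define small where "small A \<longleftrightarrow> (\<exists>C\<subseteq>T. countable C \<and> (\<forall>u\<in>A. \<exists>v\<in>C. \<forall>n. \<bar>u n - v n\<bar> \<le> \<epsilon>))"
    for A :: "(nat \<Rightarrow> real) set"
  have small_UN: "small (\<Union>b\<in>I. A b)" if I: "countable I" and A: "\<And>b. b \<in> I \<Longrightarrow> small (A b)"
    for I and A :: "(nat \<Rightarrow> real) set \<Rightarrow> _"
  proof -
    obtain C where C: "\<And>b. b \<in> I \<Longrightarrow> C b \<subseteq> T \<and> countable (C b) \<and> (\<forall>u\<in>A b. \<exists>v\<in>C b. \<forall>n. \<bar>u n - v n\<bar> \<le> \<epsilon>)"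
      using A unfolding small_def by metis
    show ?thesis
      unfolding small_def
    proof (intro exI[of _ "\<Union>b\<in>I. C b"] conjI ballI)
      fix u assume "u \<in> (\<Union>b\<in>I. A b)"
      then obtain b where "b \<in> I" "u \<in> A b" by auto
      then show "\<exists>v\<in>\<Union>b\<in>I. C b. \<forall>n. \<bar>u n - v n\<bar> \<le> \<epsilon>"
        using C[of b] by blast
    qed (use C I in auto)
  qed
  have small_mono: "small A" if "small B" "A \<subseteq> B" for A B
    using that unfolding small_def by (meson subsetD)
  obtain \<B> :: "(nat \<Rightarrow> real) set set" where \<B>: "countable \<B>" "topological_basis \<B>"
    using ex_countable_basis by blast
  define L where "L = (\<Union>b\<in>{b\<in>\<B>. small (T \<inter> b)}. T \<inter> b)"
  have L: "small L"
    unfolding L_def by (intro small_UN countable_subset[OF _ \<B>(1)]) auto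
  have "\<exists>a\<in>W \<inter> (T - L). \<exists>b\<in>W \<inter> (T - L). \<exists>n. \<epsilon> < \<bar>a n - b n\<bar>"
    if W: "open W" "W \<inter> (T - L) \<noteq> {}" for W
  proof (rule ccontr)
    assume neg: "\<not> ?thesis"
    obtain a where a: "a \<in> W" "a \<in> T" "a \<notin> L" using W by auto
    obtain b where b: "b \<in> \<B>" "a \<in> b" "b \<subseteq> W"
      using topological_basisE[OF \<B>(2) W(1) a(1)] by metis
    \<comment> \<open>If all points of \<open>W \<inter> (T - L)\<close> are within
      \<open>\<epsilon>\<close> of each other, the single point \<open>a\<close> covers them. Adding
      the small set \<open>L\<close> makes \<open>T \<inter> b\<close> small, so \<open>b\<close>
      was removed and \<open>a\<close> lies in \<open>L\<close>.\<close>
    have "small (W \<inter> (T - L))"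
      unfolding small_def
      by (rule exI[of _ "{a}"]) (use a neg in \<open>auto simp: not_less abs_minus_commute\<close>)
    then have "small (\<Union>B\<in>{W \<inter> (T - L), L}. B)"
      using L by (intro small_UN) auto
    then have "small (T \<inter> b)"
      by (rule small_mono) (use b in auto)
    then show False using a b by (auto simp: L_def)
  qed
  moreover have "T - L \<noteq> {}"
    using ns small_mono[OF L, of T] unfolding small_def by blast
  ultimately show thesis
    using that[of "T - L"] by blast
qed

text \<open>Node \<open>j\<close> has the children \<open>2 * j\<close> and
  \<open>Suc (2 * j)\<close> one level down, chosen around two points of the condensed set that
  differ by more than \<open>\<epsilon>\<close> in some coordinate. Shrinking the coordinates up to
  \<open>m\<close> makes branches converge pointwise, while the separating coordinate may lie
  arbitrarily far out.\<close>

lemma separated_dyadic_tree: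
  fixes T :: "(nat \<Rightarrow> real) set"
  assumes "\<not> (\<exists>C\<subseteq>T. countable C \<and> (\<forall>u\<in>T. \<exists>v\<in>C. \<forall>n. \<bar>u n - v n\<bar> \<le> \<epsilon>))"
  obtains a :: "nat \<Rightarrow> nat \<Rightarrow> nat \<Rightarrow> real" and W
  where "\<And>m j. a m j \<in> T" "\<And>m j. a m j \<in> W m j" "\<And>m j. W (Suc m) j \<subseteq> W m (j div 2)"
    "\<And>m j i u v. \<lbrakk>u \<in> W (Suc m) j; v \<in> W (Suc m) j; i \<le> m\<rbrakk> \<Longrightarrow> \<bar>u i - v i\<bar> \<le> (1/2) ^ m"
    "\<And>m j. \<exists>n. \<forall>u\<in>W (Suc m) (2 * j). \<forall>v\<in>W (Suc m) (Suc (2 * j)). \<epsilon> \<le> \<bar>u n - v n\<bar>"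
proof -
  obtain S where S: "S \<subseteq> T" "S \<noteq> {}"
    "\<And>W. open W \<Longrightarrow> W \<inter> S \<noteq> {} \<Longrightarrow> \<exists>a\<in>W \<inter> S. \<exists>b\<in>W \<inter> S. \<exists>n. \<epsilon> < \<bar>a n - b n\<bar>"
    using condensed_subset[OF assms] by metis
  define P where "P W \<longleftrightarrow> open W \<and> W \<inter> S \<noteq> {}" for W
  define Q where "Q m W V \<longleftrightarrow> P V \<and> V \<subseteq> W \<and> (\<forall>i\<le>m. \<forall>u\<in>V. \<forall>v\<in>V. \<bar>u i - v i\<bar> \<le> (1/2) ^ m)"
    for m and W V :: "(nat \<Rightarrow> real) set"
  have step: "\<exists>V. Q m W (fst V) \<and> Q m W (snd V) \<and> (\<exists>n. \<forall>u\<in>fst V. \<forall>v\<in>snd V. \<epsilon> \<le> \<bar>u n - v n\<bar>)"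
    if "P W" for m W
  proof -
    obtain a b n where ab: "a \<in> W \<inter> S" "b \<in> W \<inter> S" "\<epsilon> < \<bar>a n - b n\<bar>"
      using S(3) \<open>P W\<close> unfolding P_def by blast
    \<comment> \<open>Half the excess of the gap over \<open>\<epsilon>\<close>: moving both points
      by less than \<open>\<delta>\<close> in coordinate \<open>n\<close> leaves a gap of at least
      \<open>\<epsilon>\<close>.\<close>
    define \<delta> where "\<delta> = (\<bar>a n - b n\<bar> - \<epsilon>) / 2"
    define N where "N c = W \<inter> ({u. \<forall>i\<in>{..m}. u i \<in> ball (c i) ((1/2) ^ m / 2)} \<inter> {u. \<forall>i\<in>{n}. u i \<in> ball (c i) \<delta>})"
      for c :: "nat \<Rightarrow> real"
    have d: "\<delta> > 0" using ab by (simp add: \<delta>_def)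
    have N: "Q m W (N c)" if "c \<in> W \<inter> S" for c
      unfolding Q_def
    proof (intro conjI allI impI ballI)
      have "open (N c)"
        unfolding N_def using \<open>P W\<close>
        by (intro open_Int product_topology_basis'[of _ "\<lambda>i. ball (c i) _" "\<lambda>i. i"]) (auto simp: P_def)
      moreover have "c \<in> N c" using that d by (auto simp: N_def)
      ultimately show "P (N c)" using that by (auto simp: P_def)
      show "N c \<subseteq> W" by (auto simp: N_def)
      fix i u v assume "i \<le> m" "u \<in> N c" "v \<in> N c"
      then have "dist (c i) (u i) < (1/2) ^ m / 2" "dist (c i) (v i) < (1/2) ^ m / 2"
        by (auto simp: N_def)
      then have "dist (u i) (v i) < (1/2) ^ m"
        using dist_triangle_half_r by blast
      then show "\<bar>u i - v i\<bar> \<le> (1/2) ^ m"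
        by (simp add: dist_real_def)
    qed
    have "\<epsilon> \<le> \<bar>u n - v n\<bar>" if "u \<in> N a" "v \<in> N b" for u v
    proof -
      have "\<bar>a n - u n\<bar> < \<delta>" "\<bar>b n - v n\<bar> < \<delta>"
        using that by (auto simp: N_def dist_real_def)
      moreover have "\<bar>a n - b n\<bar> \<le> \<bar>a n - u n\<bar> + \<bar>u n - v n\<bar> + \<bar>b n - v n\<bar>"
        by linarith
      moreover have "\<bar>a n - b n\<bar> = 2 * \<delta> + \<epsilon>"
        by (simp add: \<delta>_def field_simps)
      ultimately show ?thesis by linarith
    qed
    then show ?thesis
      using N[OF ab(1)] N[OF ab(2)] by (intro exI[of _ "(N a, N b)"]) auto
  qed
  define V where "V m W = (SOME V. Q m W (fst V) \<and> Q m W (snd V) \<and>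
      (\<exists>n. \<forall>u\<in>fst V. \<forall>v\<in>snd V. \<epsilon> \<le> \<bar>u n - v n\<bar>))" for m W
  have V: "Q m W (fst (V m W)) \<and> Q m W (snd (V m W)) \<and>
      (\<exists>n. \<forall>u\<in>fst (V m W). \<forall>v\<in>snd (V m W). \<epsilon> \<le> \<bar>u n - v n\<bar>)" if "P W" for m W
    using someI_ex[OF step[OF that, of m]] by (simp only: V_def)
  \<comment> \<open>The parent of node \<open>j\<close> is \<open>j div 2\<close>, and the parity of
    \<open>j\<close> selects the half. All roots are the whole space, so \<open>j\<close> can range
    over all natural numbers rather than those below \<open>2 ^ m\<close>.\<close>
  define W :: "nat \<Rightarrow> nat \<Rightarrow> (nat \<Rightarrow> real) set" where
    "W = rec_nat (\<lambda>_. UNIV) (\<lambda>m w j. (if even j then fst else snd) (V m (w (j div 2))))"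
  have W_Suc: "W (Suc m) j = (if even j then fst else snd) (V m (W m (j div 2)))" for m j
    by (simp add: W_def)
  have PW: "P (W m j)" for m j
  proof (induction m arbitrary: j)
    case 0
    show ?case using S(2) by (simp add: P_def W_def)
  next
    case (Suc m)
    show ?case using V[OF Suc, of m "j div 2"] by (simp add: W_Suc Q_def)
  qed
  have QW: "Q m (W m (j div 2)) (W (Suc m) j)" for m j
    using V[OF PW, of m m "j div 2"] by (simp add: W_Suc)
  have "\<exists>a. a \<in> W m j \<inter> S" for m j
    using PW[of m j] by (auto simp: P_def)
  then obtain a where a: "\<And>m j. a m j \<in> W m j \<inter> S" by metis
  show thesis
  proof
    show "a m j \<in> T" "a m j \<in> W m j" for m j
      using a[of m j] S(1) by auto
    show "W (Suc m) j \<subseteq> W m (j div 2)" for m j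
      using QW[of m j] by (simp add: Q_def)
    show "\<bar>u i - v i\<bar> \<le> (1/2) ^ m" if "u \<in> W (Suc m) j" "v \<in> W (Suc m) j" "i \<le> m" for m j i u v
      using QW[of m j] that by (simp add: Q_def)
    show "\<exists>n. \<forall>u\<in>W (Suc m) (2 * j). \<forall>v\<in>W (Suc m) (Suc (2 * j)). \<epsilon> \<le> \<bar>u n - v n\<bar>" for m j
      using V[OF PW, of m m j] by (simp add: W_Suc)
  qed
qed

section \<open>Vector measures from weak* limits and their densities\<close>

text \<open>\<open>G A\<close> maps \<open>x\<close> to a generalized limit of the integrals of
  \<open>Y n \<sigma> x\<close> over \<open>A\<close>. The estimate
  \<open>norm (G A) \<le> N * measure M A\<close> yields countable additivity, finite variation and
  absolute continuity. If \<open>Y n \<sigma> x\<close> converges for all \<open>\<sigma>\<close>,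
  dominated convergence makes the limit a density of \<open>G\<close> at \<open>x\<close>, and
  densities are unique almost everywhere.\<close>

lemma weak_star_limit_density:
  fixes Y :: "nat \<Rightarrow> 'm \<Rightarrow> 'b::banach \<Rightarrow>\<^sub>L real"
  assumes "finite_measure M" and rnp: "radon_nikodym_property_wrt M TYPE('b \<Rightarrow>\<^sub>L real)"
    and Y [measurable]: "\<And>n x. (\<lambda>\<sigma>. blinfun_apply (Y n \<sigma>) x) \<in> borel_measurable M"
    and N: "\<And>n \<sigma>. norm (Y n \<sigma>) \<le> N"
  obtains h where "h \<in> bochner_L1 M"
    "\<And>x \<alpha>. (\<And>\<sigma>. \<sigma> \<in> space M \<Longrightarrow> (\<lambda>n. blinfun_apply (Y n \<sigma>) x) \<longlonglongrightarrow> \<alpha> \<sigma>)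
      \<Longrightarrow> AE \<sigma> in M. blinfun_apply (h \<sigma>) x = \<alpha> \<sigma>"
proof -
  interpret finite_measure M by fact
  have N0: "0 \<le> N" using N[of 0 undefined] norm_ge_zero order_trans by blast
  have Yb: "\<bar>blinfun_apply (Y n \<sigma>) x\<bar> \<le> N * norm x" for n \<sigma> x
    using norm_blinfun[of "Y n \<sigma>" x] mult_right_mono[OF N[of n \<sigma>], of "norm x"] by simp
  have int: "integrable M (\<lambda>\<sigma>. indicator A \<sigma> * blinfun_apply (Y n \<sigma>) x)" if "A \<in> sets M" for A n x
  proof (rule integrable_const_bound[where B = "N * norm x"])
    show "(\<lambda>\<sigma>. indicator A \<sigma> * blinfun_apply (Y n \<sigma>) x) \<in> borel_measurable M"
      using that by measurable
  qed (use Yb N0 in \<open>auto simp: indicator_def\<close>)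
  \<comment> \<open>The integrals need not converge along \<open>n\<close> at every vector \<open>snd p\<close>, so the vector measure is
    their limit along a subfilter.\<close>
  define I where "I n p = (if fst p \<in> sets M then \<integral>\<sigma>. indicator (fst p) \<sigma> * blinfun_apply (Y n \<sigma>) (snd p) \<partial>M else 0)"
    for n and p :: "'m set \<times> 'b"
  \<comment> \<open>The default value 0 off the measurable sets makes this bound, and with it the
    norm estimate of \<open>G\<close>, valid for every set.\<close>
  have I_bound: "\<bar>I n p\<bar> \<le> N * measure M (fst p) * norm (snd p)" for n p
  proof (cases "fst p \<in> sets M")
    case True
    have "\<bar>I n p\<bar> \<le> (\<integral>\<sigma>. \<bar>indicator (fst p) \<sigma> * blinfun_apply (Y n \<sigma>) (snd p)\<bar> \<partial>M)"
      using True by (simp add: I_def integral_abs_bound)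
    also have "\<dots> \<le> (\<integral>\<sigma>. indicator (fst p) \<sigma> * (N * norm (snd p)) \<partial>M)"
      using True Yb
      by (intro integral_mono integrable_abs int integrable_mult_left)
         (auto simp: abs_mult mult_left_mono less_top[symmetric])
    also have "\<dots> = N * measure M (fst p) * norm (snd p)"
      using True by (simp add: mult_ac)
    finally show ?thesis .
  qed (use N0 in \<open>simp add: I_def\<close>)
  obtain l F where F: "F \<noteq> bot" "F \<le> sequentially" "\<And>p. ((\<lambda>n. I n p) \<longlongrightarrow> l p) F"
    using pointwise_bounded_convergent_subfilter[of I, OF I_bound] by metis
  have l_eq: "l p = c" if "((\<lambda>n. I n p) \<longlongrightarrow> c) F" for p c
    using tendsto_unique[OF F(1) F(3) that] .
  have l_bound: "\<bar>l p\<bar> \<le> N * measure M (fst p) * norm (snd p)" for p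
    using tendsto_rabs[OF F(3)] by (rule tendsto_upperbound) (use I_bound F(1) in auto)
  have lin: "bounded_linear (\<lambda>x. l (A, x))" for A
  proof (rule bounded_linear_intro)
    show "l (A, x + y) = l (A, x) + l (A, y)" for x y
    proof (rule l_eq)
      have "I n (A, x + y) = I n (A, x) + I n (A, y)" for n
        by (simp add: I_def blinfun.add_right distrib_left int)
      then show "((\<lambda>n. I n (A, x + y)) \<longlongrightarrow> l (A, x) + l (A, y)) F"
        by (simp add: tendsto_add F(3))
    qed
    show "l (A, r *\<^sub>R x) = r *\<^sub>R l (A, x)" for r x
    proof (rule l_eq)
      have "I n (A, r *\<^sub>R x) = r *\<^sub>R I n (A, x)" for n
        by (simp add: I_def blinfun.scaleR_right mult.left_commute)
      then show "((\<lambda>n. I n (A, r *\<^sub>R x)) \<longlongrightarrow> r *\<^sub>R l (A, x)) F"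
        by (simp only: tendsto_scaleR F(3) tendsto_const)
    qed
    show "norm (l (A, x)) \<le> norm x * (N * measure M A)" for x
      using l_bound[of "(A, x)"] by (simp add: mult_ac)
  qed
  define G where "G A = Blinfun (\<lambda>x. l (A, x))" for A
  have G: "blinfun_apply (G A) x = l (A, x)" for A x
    by (simp add: G_def bounded_linear_Blinfun_apply[OF lin])
  have G_norm: "norm (G A) \<le> N * measure M A" for A
    using l_bound N0 by (intro norm_blinfun_bound) (auto simp: G)
  have G_Un: "G (A \<union> B) = G A + G B" if AB: "A \<in> sets M" "B \<in> sets M" "A \<inter> B = {}" for A B
  proof (intro blinfun_eqI)
    fix x
    have "indicator (A \<union> B) \<sigma> = (indicator A \<sigma> + indicator B \<sigma> :: real)" for \<sigma>
      using AB(3) by (auto simp: indicator_def)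
    then have "I n (A \<union> B, x) = I n (A, x) + I n (B, x)" for n
      using AB by (simp add: I_def distrib_right int)
    then show "blinfun_apply (G (A \<union> B)) x = blinfun_apply (G A + G B) x"
      unfolding blinfun.add_left G by (intro l_eq) (simp add: tendsto_add F(3))
  qed
  have G_empty: "G {} = 0"
    using G_norm[of "{}"] by simp
  have "vector_measure M G"
    unfolding vector_measure_def
  proof (intro allI impI)
    fix A :: "nat \<Rightarrow> 'm set"
    assume A: "range A \<subseteq> sets M" "disjoint_family A"
    have G_sum: "(\<Sum>i<n. G (A i)) = G (\<Union>i<n. A i)" for n
    proof (induction n)
      case (Suc n)
      have "A i \<inter> A n = {}" if "i < n" for i
        using disjoint_family_onD[OF A(2), of i n] that by simp
      then have "G ((\<Union>i<n. A i) \<union> A n) = G (\<Union>i<n. A i) + G (A n)"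
        using A(1) by (intro G_Un) auto
      then show ?case using Suc by (simp add: lessThan_Suc Un_commute)
    qed (simp add: G_empty)
    \<comment> \<open>The error of a partial sum is \<open>G\<close> of the uncovered remainder
      \<open>R\<close>, whose measure tends to 0.\<close>
    have "norm ((\<Sum>i<n. G (A i)) - G (\<Union>i. A i)) \<le> N * (measure M (\<Union>i. A i) - (\<Sum>i<n. measure M (A i)))" for n
    proof -
      define R where "R = (\<Union>i. A i) - (\<Union>i<n. A i)"
      have "G ((\<Union>i<n. A i) \<union> R) = G (\<Union>i<n. A i) + G R"
        using A by (intro G_Un) (auto simp: R_def)
      moreover have "(\<Union>i<n. A i) \<union> R = (\<Union>i. A i)" by (auto simp: R_def)
      ultimately have "norm ((\<Sum>i<n. G (A i)) - G (\<Union>i. A i)) \<le> N * measure M R"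
        using G_norm[of R] by (simp add: G_sum norm_minus_commute)
      also have "measure M R = measure M (\<Union>i. A i) - measure M (\<Union>i<n. A i)"
        unfolding R_def using A by (intro finite_measure_Diff) auto
      also have "measure M (\<Union>i<n. A i) = (\<Sum>i<n. measure M (A i))"
        using A by (intro finite_measure_finite_Union) (auto simp: disjoint_family_on_def)
      finally show ?thesis .
    qed
    then have "eventually (\<lambda>n. norm ((\<Sum>i<n. G (A i)) - G (\<Union>i. A i))
        \<le> N * (measure M (\<Union>i. A i) - (\<Sum>i<n. measure M (A i)))) sequentially"
      by (intro always_eventually allI)
    moreover have "(\<lambda>n. N * (measure M (\<Union>i. A i) - (\<Sum>i<n. measure M (A i)))) \<longlonglongrightarrow> N * (measure M (\<Union>i. A i) - measure M (\<Union>i. A i))"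
      using finite_measure_UNION[OF A] unfolding sums_def by (intro tendsto_intros)
    ultimately have "(\<lambda>n. (\<Sum>i<n. G (A i)) - G (\<Union>i. A i)) \<longlonglongrightarrow> 0"
      unfolding diff_self mult_zero_right by (rule Lim_null_comparison)
    then show "(\<lambda>n. G (A n)) sums G (\<Union>n. A n)"
      unfolding sums_def using LIM_zero_iff by blast
  qed
  moreover have "finite_variation M G"
    unfolding finite_variation_def
  proof (intro exI allI impI)
    fix P assume P: "finite P" "P \<subseteq> sets M" "disjoint P"
    have "(\<Sum>A\<in>P. norm (G A)) \<le> (\<Sum>A\<in>P. N * measure M A)"
      by (intro sum_mono G_norm)
    also have "\<dots> = N * measure M (\<Union>A\<in>P. A)"
      using P by (subst finite_measure_finite_Union) (auto simp: sum_distrib_left disjoint_family_on_def disjoint_def)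
    also have "\<dots> \<le> N * measure M (space M)"
      using N0 by (intro mult_left_mono bounded_measure)
    finally show "(\<Sum>A\<in>P. norm (G A)) \<le> N * measure M (space M)" .
  qed
  moreover have "\<forall>A\<in>null_sets M. G A = 0"
    using G_norm by (auto simp: null_sets_def measure_eq_emeasure_eq_ennreal measure_def) (metis mult_zero_right norm_le_zero_iff enn2real_0)
  ultimately obtain h where h: "h \<in> bochner_L1 M"
    "\<And>A. A \<in> sets M \<Longrightarrow> has_strong_bochner_integral M (\<lambda>\<omega>. indicator A \<omega> *\<^sub>R h \<omega>) (G A)"
    using rnp unfolding radon_nikodym_property_wrt_def by blast
  have "AE \<sigma> in M. blinfun_apply (h \<sigma>) x = \<alpha> \<sigma>"
    if \<alpha>: "\<And>\<sigma>. \<sigma> \<in> space M \<Longrightarrow> (\<lambda>n. blinfun_apply (Y n \<sigma>) x) \<longlonglongrightarrow> \<alpha> \<sigma>" for x \<alpha>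
  proof (rule density_unique_real)
    have hx: "has_bochner_integral M (\<lambda>\<sigma>. indicator A \<sigma> * blinfun_apply (h \<sigma>) x) (l (A, x))"
      if "A \<in> sets M" for A
      using has_strong_bochner_integral_bounded_linear[OF h(2)[OF that] blinfun.bounded_linear_left[of x]]
      by (simp add: blinfun.scaleR_left G)
    have "has_bochner_integral M (\<lambda>\<sigma>. blinfun_apply (h \<sigma>) x) (l (space M, x))"
      using hx[OF sets.top] by (rule has_bochner_integral_cong[THEN iffD1, rotated -1]) auto
    then show "integrable M (\<lambda>\<sigma>. blinfun_apply (h \<sigma>) x)"
      by (rule integrable.intros)
    have meas [measurable]: "\<alpha> \<in> borel_measurable M"
      by (rule borel_measurable_LIMSEQ_real[OF \<alpha> Y])
    have \<alpha>_bound: "\<bar>\<alpha> \<sigma>\<bar> \<le> N * norm x" if "\<sigma> \<in> space M" for \<sigma>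
      using tendsto_rabs[OF \<alpha>[OF that]] by (rule tendsto_upperbound) (use Yb in auto)
    then show "integrable M \<alpha>"
      by (intro integrable_const_bound[where B = "N * norm x"]) auto
    show "(\<integral>\<sigma>\<in>A. blinfun_apply (h \<sigma>) x \<partial>M) = (\<integral>\<sigma>\<in>A. \<alpha> \<sigma> \<partial>M)" if A: "A \<in> sets M" for A
    proof -
      have "(\<lambda>n. \<integral>\<sigma>. indicator A \<sigma> * blinfun_apply (Y n \<sigma>) x \<partial>M) \<longlonglongrightarrow> (\<integral>\<sigma>. indicator A \<sigma> * \<alpha> \<sigma> \<partial>M)"
      proof (rule integral_dominated_convergence[where w = "\<lambda>_. N * norm x"])
        show "AE \<sigma> in M. (\<lambda>n. indicator A \<sigma> * blinfun_apply (Y n \<sigma>) x) \<longlonglongrightarrow> indicator A \<sigma> * \<alpha> \<sigma>"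
          using \<alpha> by (intro AE_I2 tendsto_mult tendsto_const)
      qed (use A Yb N0 in \<open>auto simp: indicator_def\<close>)
      \<comment> \<open>As \<open>F\<close> is finer than \<open>sequentially\<close>, the ordinary
        limit is also the limit along \<open>F\<close>, hence equals
        \<open>l (A, x)\<close>.\<close>
      then have "((\<lambda>n. I n (A, x)) \<longlongrightarrow> (\<integral>\<sigma>. indicator A \<sigma> * \<alpha> \<sigma> \<partial>M)) F"
        using A F(2) by (auto simp: I_def intro: tendsto_mono)
      then have "l (A, x) = (\<integral>\<sigma>. indicator A \<sigma> * \<alpha> \<sigma> \<partial>M)"
        by (rule l_eq)
      then show ?thesis
        using has_bochner_integral_integral_eq[OF hx[OF A]] by (simp add: set_lebesgue_integral_def)
    qed
  qed
  with h(1) show thesis by (rule that)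
qed

section \<open>Stegall's argument\<close>

text \<open>Restrictions to \<open>d\<close> are compared in the supremum norm. The bound on
  \<open>norm (d n)\<close> turns a gap between two branches in one coordinate into a lower bound
  for the distance of the corresponding values of the density.\<close>

lemma rnp_dual_separable_on_sequence:
  fixes d :: "nat \<Rightarrow> 'e::banach" and N \<epsilon> :: real
  assumes rnp: "radon_nikodym_property TYPE('e \<Rightarrow>\<^sub>L real)" and d: "\<And>n. norm (d n) \<le> 1" and "0 < \<epsilon>"
  defines "T \<equiv> (\<lambda>(\<psi> :: 'e \<Rightarrow>\<^sub>L real) n. blinfun_apply \<psi> (d n)) ` {\<psi>. norm \<psi> \<le> N}"
  shows "\<exists>C\<subseteq>T. countable C \<and> (\<forall>u\<in>T. \<exists>v\<in>C. \<forall>n. \<bar>u n - v n\<bar> \<le> \<epsilon>)"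
proof (rule ccontr)
  assume "\<not> ?thesis"
  from separated_dyadic_tree[OF this] obtain a W where
    aT: "\<And>m j. a m j \<in> T" and aW: "\<And>m j. a m j \<in> W m j"
    and nest: "\<And>m j. W (Suc m) j \<subseteq> W m (j div 2)"
    and diam: "\<And>m j i u v. \<lbrakk>u \<in> W (Suc m) j; v \<in> W (Suc m) j; i \<le> m\<rbrakk> \<Longrightarrow> \<bar>u i - v i\<bar> \<le> (1/2) ^ m"
    and sep: "\<And>m j. \<exists>n. \<forall>u\<in>W (Suc m) (2 * j). \<forall>v\<in>W (Suc m) (Suc (2 * j)). \<epsilon> \<le> \<bar>u n - v n\<bar>"
    by blast
  have "\<exists>\<psi>. norm \<psi> \<le> N \<and> a m j = (\<lambda>n. blinfun_apply \<psi> (d n))" for m j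
    using aT[of m j] unfolding T_def by blast
  then obtain \<psi> where \<psi>: "\<And>m j. norm (\<psi> m j) \<le> N" "\<And>m j n. a m j n = blinfun_apply (\<psi> m j) (d n)"
    by metis
  \<comment> \<open>The index of the dyadic interval of length \<open>(1/2) ^ m\<close> containing
    \<sigma>; the branch of \<sigma> passes through these nodes.\<close>
  define J where "J m \<sigma> = nat \<lfloor>2 ^ m * \<sigma>\<rfloor>" for m and \<sigma> :: real
  have J_Suc: "J (Suc m) \<sigma> div 2 = J m \<sigma>" for m \<sigma>
  proof -
    have "\<lfloor>2 ^ m * \<sigma>\<rfloor> = \<lfloor>2 ^ Suc m * \<sigma>\<rfloor> div 2"
      using floor_divide_real_eq_div[of 2 "2 ^ Suc m * \<sigma>"] by (simp add: mult_ac)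
    then show ?thesis
      by (simp add: J_def nat_div_distrib)
  qed
  have W_mono: "W (m + k) (J (m + k) \<sigma>) \<subseteq> W m (J m \<sigma>)" for m k \<sigma>
  proof (induction k)
    case (Suc k)
    then show ?case
      using nest[of "m + k" "J (Suc (m + k)) \<sigma>"] by (simp only: J_Suc add_Suc_right)
  qed simp
  have a_in: "a m' (J m' \<sigma>) \<in> W m (J m \<sigma>)" if "m \<le> m'" for m m' \<sigma>
    using aW[of m' "J m' \<sigma>"] W_mono[of m "m' - m" \<sigma>] that by auto
  have "convergent (\<lambda>m. a m (J m \<sigma>) n)" for \<sigma> n
  proof (rule Cauchy_convergent, rule metric_CauchyI)
    fix e :: real assume "0 < e"
    then have "eventually (\<lambda>p. (1/2 :: real) ^ p < e) sequentially"
      by (intro order_tendstoD(2)[OF LIMSEQ_power_zero]) auto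
    \<comment> \<open>Coordinate \<open>n\<close> is controlled from level \<open>p \<ge> n\<close>
      on, and all later points of the branch stay in its node at level \<open>Suc p\<close>.\<close>
    then obtain p where p: "(1/2 :: real) ^ p < e" "n \<le> p"
      using eventually_happens'[OF sequentially_bot eventually_conj[OF _ eventually_ge_at_top[of n]]] by blast
    show "\<exists>m0. \<forall>m\<ge>m0. \<forall>m'\<ge>m0. dist (a m (J m \<sigma>) n) (a m' (J m' \<sigma>) n) < e"
    proof (intro exI allI impI)
      fix m m' assume "Suc p \<le> m" "Suc p \<le> m'"
      then have "\<bar>a m (J m \<sigma>) n - a m' (J m' \<sigma>) n\<bar> \<le> (1/2) ^ p"
        by (intro diam[OF a_in a_in p(2)])
      then show "dist (a m (J m \<sigma>) n) (a m' (J m' \<sigma>) n) < e"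
        using p(1) by (simp add: dist_real_def)
    qed
  qed
  moreover define \<alpha> where "\<alpha> n \<sigma> = lim (\<lambda>m. a m (J m \<sigma>) n)" for n \<sigma>
  ultimately have \<alpha>: "(\<lambda>m. a m (J m \<sigma>) n) \<longlonglongrightarrow> \<alpha> n \<sigma>" for n \<sigma>
    by (simp add: convergent_LIMSEQ_iff)

  have \<alpha>_sep: "\<exists>n. \<epsilon> \<le> \<bar>\<alpha> n \<sigma> - \<alpha> n \<tau>\<bar>" if \<sigma>\<tau>: "\<sigma> \<in> {0..<1}" "\<tau> \<in> {0..<1}" "\<sigma> < \<tau>" for \<sigma> \<tau>
  proof -
    obtain m where "1 / (\<tau> - \<sigma>) < 2 ^ m"
      using real_arch_pow[of 2 "1 / (\<tau> - \<sigma>)"] by auto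
    then have "2 ^ m * \<sigma> + 1 < 2 ^ m * \<tau>"
      using \<sigma>\<tau> by (simp add: field_simps)
    moreover have "0 \<le> 2 ^ m * \<sigma>" using \<sigma>\<tau> by simp
    ultimately have "J m \<sigma> < J m \<tau>"
      unfolding J_def by linarith
    then have "\<exists>m. J m \<sigma> \<noteq> J m \<tau>" by (metis less_irrefl)
    \<comment> \<open>At the first level where the nodes differ their parents agree, so they are
      siblings. Level 0 is excluded because all points of [0,1) have index 0 there.\<close>
    then obtain p where p: "J p \<sigma> \<noteq> J p \<tau>" "\<And>q. q < p \<Longrightarrow> J q \<sigma> = J q \<tau>"
      using exists_least_iff[of "\<lambda>m. J m \<sigma> \<noteq> J m \<tau>"] by blast
    have "J 0 \<sigma> = 0" "J 0 \<tau> = 0" using \<sigma>\<tau> by (simp_all add: J_def floor_eq_iff nat_eq_iff)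
    then have "p \<noteq> 0" using p(1) by (metis)
    then obtain m where m: "p = Suc m" by (cases p) auto
    define j where "j = J m \<sigma>"
    have j: "J (Suc m) \<sigma> div 2 = j" "J (Suc m) \<tau> div 2 = j"
      using p(2)[of m] by (simp_all add: J_Suc j_def m)
    obtain n where n: "\<And>u v. u \<in> W (Suc m) (2 * j) \<Longrightarrow> v \<in> W (Suc m) (Suc (2 * j)) \<Longrightarrow> \<epsilon> \<le> \<bar>u n - v n\<bar>"
      using sep by blast
    have "J (Suc m) \<sigma> = 2 * j \<and> J (Suc m) \<tau> = Suc (2 * j) \<or> J (Suc m) \<tau> = 2 * j \<and> J (Suc m) \<sigma> = Suc (2 * j)"
      using j p(1) unfolding m by linarith
    then have "\<epsilon> \<le> \<bar>a m' (J m' \<sigma>) n - a m' (J m' \<tau>) n\<bar>" if "Suc m \<le> m'" for m'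
      using n[of "a m' (J m' \<sigma>)" "a m' (J m' \<tau>)"] n[of "a m' (J m' \<tau>)" "a m' (J m' \<sigma>)"]
        a_in[OF that, of \<sigma>] a_in[OF that, of \<tau>] by (auto simp: abs_minus_commute)
    then have "eventually (\<lambda>m'. \<epsilon> \<le> \<bar>a m' (J m' \<sigma>) n - a m' (J m' \<tau>) n\<bar>) sequentially"
      unfolding eventually_sequentially by blast
    then have "\<epsilon> \<le> \<bar>\<alpha> n \<sigma> - \<alpha> n \<tau>\<bar>"
      by (intro tendsto_lowerbound[OF tendsto_rabs[OF tendsto_diff[OF \<alpha> \<alpha>]]]) auto
    then show ?thesis by blast
  qed

  \<comment> \<open>Lebesgue measure on [0,1), kept as a measure on the reals because the
    Radon-Nikodym property is stated for those.\<close>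
  define \<Lambda> :: "real measure" where "\<Lambda> = restrict_space lborel {0..<1}"
  have fin: "finite_measure \<Lambda>"
    by (rule finite_measureI) (simp add: \<Lambda>_def emeasure_restrict_space space_restrict_space)
  have "J m \<in> borel \<rightarrow>\<^sub>M count_space UNIV" for m
    unfolding J_def by measurable
  then have J_meas: "J m \<in> \<Lambda> \<rightarrow>\<^sub>M count_space UNIV" for m
    unfolding \<Lambda>_def by (intro measurable_restrict_space1) simp
  obtain h where h: "h \<in> bochner_L1 \<Lambda>"
    "\<And>x \<beta>. (\<And>\<sigma>. \<sigma> \<in> space \<Lambda> \<Longrightarrow> (\<lambda>m. blinfun_apply (\<psi> m (J m \<sigma>)) x) \<longlonglongrightarrow> \<beta> \<sigma>)
      \<Longrightarrow> AE \<sigma> in \<Lambda>. blinfun_apply (h \<sigma>) x = \<beta> \<sigma>"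
  proof (rule weak_star_limit_density[of \<Lambda> "\<lambda>m \<sigma>. \<psi> m (J m \<sigma>)" N])
    show "(\<lambda>\<sigma>. blinfun_apply (\<psi> m (J m \<sigma>)) x) \<in> borel_measurable \<Lambda>" for m x
      by (rule measurable_compose[OF J_meas]) simp
  qed (use fin rnp \<psi> in \<open>auto simp: radon_nikodym_property_def\<close>)
  \<comment> \<open>Only the countably many vectors \<open>d n\<close> are tested, so the
    exceptional null sets combine into one.\<close>
  have "AE \<sigma> in \<Lambda>. \<forall>n. blinfun_apply (h \<sigma>) (d n) = \<alpha> n \<sigma>"
    unfolding AE_all_countable using h(2) \<alpha> by (auto simp: \<psi>)
  moreover define Z where "Z = {\<sigma>\<in>{0..<1}. \<forall>n. blinfun_apply (h \<sigma>) (d n) = \<alpha> n \<sigma>}"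
  ultimately have AE_Z: "AE \<sigma> in lborel. \<sigma> \<in> {0..<1} \<longrightarrow> \<sigma> \<in> Z"
    unfolding \<Lambda>_def by (subst (asm) AE_restrict_space_iff) auto
  have h_sep: "\<epsilon> \<le> dist (h \<sigma>) (h \<tau>)" if "\<sigma> \<in> Z" "\<tau> \<in> Z" "\<sigma> < \<tau>" for \<sigma> \<tau>
  proof -
    obtain n where "\<epsilon> \<le> \<bar>\<alpha> n \<sigma> - \<alpha> n \<tau>\<bar>"
      using \<alpha>_sep[of \<sigma> \<tau>] \<open>\<sigma> \<in> Z\<close> \<open>\<tau> \<in> Z\<close> \<open>\<sigma> < \<tau>\<close> unfolding Z_def by blast
    also have "\<dots> = norm (blinfun_apply (h \<sigma> - h \<tau>) (d n))"
      using that by (simp add: Z_def blinfun.diff_left)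
    also have "\<dots> \<le> norm (h \<sigma> - h \<tau>) * norm (d n)"
      by (rule norm_blinfun)
    also have "\<dots> \<le> norm (h \<sigma> - h \<tau>) * 1"
      by (intro mult_left_mono d) auto
    finally show ?thesis by (simp add: dist_norm)
  qed
  obtain C where C: "countable C" "h ` space \<Lambda> \<subseteq> closure C"
    using strongly_measurable_range_separable[OF bochner_L1_strongly_measurable[OF h(1)]] .
  \<comment> \<open>A choice of points of \<open>C\<close> this close to the values of
    \<open>h\<close> is injective on \<open>Z\<close>, since those values are at least
    \<open>\<epsilon>\<close> apart. So a set of full measure would be countable.\<close>
  have "\<exists>c\<in>C. dist c (h \<sigma>) < \<epsilon> / 2" if "\<sigma> \<in> Z" for \<sigma>
  proof -
    have "h \<sigma> \<in> closure C"
      using C(2) that by (auto simp: Z_def \<Lambda>_def space_restrict_space)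
    then show ?thesis
      using \<open>0 < \<epsilon>\<close> unfolding closure_approachable by (meson half_gt_zero)
  qed
  then obtain c where c: "\<And>\<sigma>. \<sigma> \<in> Z \<Longrightarrow> c \<sigma> \<in> C" "\<And>\<sigma>. \<sigma> \<in> Z \<Longrightarrow> dist (c \<sigma>) (h \<sigma>) < \<epsilon> / 2"
    by metis
  have "inj_on c Z"
  proof (rule linorder_inj_onI)
    fix \<sigma> \<tau> assume "\<sigma> < \<tau>" "\<sigma> \<in> Z" "\<tau> \<in> Z"
    then show "c \<sigma> \<noteq> c \<tau>"
      using h_sep c(2) dist_triangle_half_r[of "c \<sigma>" "h \<sigma>" \<epsilon> "h \<tau>"] by fastforce
  qed auto
  then have "countable Z"
    using c(1) by (intro countable_image_inj_on[of c Z] countable_subset[OF _ C(1)]) auto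
  then have "AE \<sigma> in lborel. \<sigma> \<notin> Z"
    by (intro AE_not_in countable_imp_null_set_lborel)
  with AE_Z have "AE \<sigma> in lborel. \<sigma> \<notin> {0..<1::real}"
    by eventually_elim auto
  then have "{0..<1::real} \<in> null_sets lborel"
    by (simp add: AE_iff_null_sets)
  then show False by auto
qed

text \<open>Vectors are scaled into the unit ball to fit the preceding lemma; the weight
  \<open>max 1 (norm x)\<close> undoes the scaling and never vanishes. Integer radii
  \<open>N\<close> and tolerances \<open>1 / Suc k\<close> keep the family countable, and the
  estimate passes from \<open>D\<close> to its closure by continuity.\<close>

lemma rnp_dual_separable_on_closure:
  fixes D :: "'e::banach set"
  assumes rnp: "radon_nikodym_property TYPE('e \<Rightarrow>\<^sub>L real)" and D: "countable D"
  obtains \<Phi> :: "('e \<Rightarrow>\<^sub>L real) set" where "countable \<Phi>"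
    "\<And>\<psi> \<epsilon>. 0 < \<epsilon> \<Longrightarrow> \<exists>\<phi>\<in>\<Phi>. \<forall>x\<in>closure D. \<bar>blinfun_apply \<phi> x - blinfun_apply \<psi> x\<bar> \<le> \<epsilon> * max 1 (norm x)"
proof -
  define r where "r x = x /\<^sub>R max 1 (norm x)" for x :: 'e
  define d where "d n = r (from_nat_into (insert 0 D) n)" for n
  have d: "norm (d n) \<le> 1" for n
    by (simp add: d_def r_def divide_simps)
  define E where "E = (\<lambda>(\<psi> :: 'e \<Rightarrow>\<^sub>L real) n. blinfun_apply \<psi> (d n))"
  define T where "T N = E ` {\<psi>. norm \<psi> \<le> N}" for N
  have "\<exists>C\<subseteq>T (real N). countable C \<and> (\<forall>u\<in>T (real N). \<exists>v\<in>C. \<forall>n. \<bar>u n - v n\<bar> \<le> 1 / Suc k)" for N k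
    unfolding T_def E_def by (rule rnp_dual_separable_on_sequence[OF rnp d]) simp
  then obtain C where C: "\<And>N k. C N k \<subseteq> T (real N)" "\<And>N k. countable (C N k)"
    "\<And>N k u. u \<in> T (real N) \<Longrightarrow> \<exists>v\<in>C N k. \<forall>n. \<bar>u n - v n\<bar> \<le> 1 / Suc k"
    by metis
  \<comment> \<open>Some functional with the prescribed values on \<open>d\<close> is picked,
    without control of its norm; the estimate uses only these values.\<close>
  define \<rho> where "\<rho> = inv E"
  have \<rho>: "blinfun_apply (\<rho> v) (d n) = v n" if "v \<in> T N" for v N n
  proof -
    have "E (\<rho> v) = v"
      unfolding \<rho>_def using that by (intro f_inv_into_f) (auto simp: T_def)
    then show ?thesis
      unfolding E_def by (rule fun_cong)
  qed
  show thesis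
  proof
    show "countable (\<rho> ` (\<Union>N k. C N k))"
      using C(2) by simp
    fix \<psi> :: "'e \<Rightarrow>\<^sub>L real" and \<epsilon> :: real assume "0 < \<epsilon>"
    obtain N k :: nat where Nk: "norm \<psi> \<le> real N" "1 / Suc k < \<epsilon>"
      using real_arch_simple reals_Archimedean[OF \<open>0 < \<epsilon>\<close>] by (metis inverse_eq_divide)
    have "(\<lambda>n. blinfun_apply \<psi> (d n)) \<in> T (real N)"
      using Nk(1) by (auto simp: T_def E_def)
    then obtain v where v: "v \<in> C N k" "\<And>n. \<bar>blinfun_apply \<psi> (d n) - v n\<bar> \<le> 1 / Suc k"
      using C(3) by blast
    have "\<bar>blinfun_apply (\<rho> v) x - blinfun_apply \<psi> x\<bar> \<le> \<epsilon> * max 1 (norm x)" if "x \<in> D" for x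
    proof -
      obtain n where "from_nat_into (insert 0 D) n = x"
        using from_nat_into_surj[of "insert 0 D" x] D \<open>x \<in> D\<close> by auto
      then have n: "d n = r x" by (simp add: d_def)
      have \<rho>v: "blinfun_apply (\<rho> v) (d n) = v n"
        using \<rho> C(1) v(1) by blast
      have x: "x = max 1 (norm x) *\<^sub>R d n"
        by (simp add: n r_def)
      have "\<bar>blinfun_apply (\<rho> v) x - blinfun_apply \<psi> x\<bar> = max 1 (norm x) * \<bar>v n - blinfun_apply \<psi> (d n)\<bar>"
        by (subst (1 2) x) (simp add: blinfun.scaleR_right \<rho>v abs_mult flip: right_diff_distrib)
      also have "\<dots> \<le> max 1 (norm x) * \<epsilon>"
        using v(2)[of n] Nk(2) by (intro mult_left_mono) (auto simp: abs_minus_commute)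
      finally show ?thesis by (simp add: mult.commute)
    qed
    moreover have "closed {x. \<bar>blinfun_apply (\<rho> v) x - blinfun_apply \<psi> x\<bar> \<le> \<epsilon> * max 1 (norm x)}"
      by (intro closed_Collect_le continuous_intros)
    ultimately have "closure D \<subseteq> {x. \<bar>blinfun_apply (\<rho> v) x - blinfun_apply \<psi> x\<bar> \<le> \<epsilon> * max 1 (norm x)}"
      by (intro closure_minimal) auto
    then show "\<exists>\<phi>\<in>\<rho> ` (\<Union>N k. C N k). \<forall>x\<in>closure D. \<bar>blinfun_apply \<phi> x - blinfun_apply \<psi> x\<bar> \<le> \<epsilon> * max 1 (norm x)"
      using v(1) by blast
  qed
qed

section \<open>Limited convergence\<close>

text \<open>Otherwise infinitely many terms stay at distance at least \<open>e\<close> from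
  \<open>l\<close>, and the subsequence enumerating them has no further subsequence tending to
  \<open>l\<close>.\<close>

lemma tendsto_subsequenceI:
  fixes X :: "nat \<Rightarrow> 'a::metric_space"
  assumes "\<And>r :: nat \<Rightarrow> nat. strict_mono r \<Longrightarrow> \<exists>s :: nat \<Rightarrow> nat. strict_mono s \<and> (\<lambda>k. X (r (s k))) \<longlonglongrightarrow> l"
  shows "X \<longlonglongrightarrow> l"
proof (rule ccontr)
  assume "\<not> X \<longlonglongrightarrow> l"
  then obtain e where e: "0 < e" "\<not> eventually (\<lambda>k. dist (X k) l < e) sequentially"
    unfolding tendsto_iff by blast
  define I where "I = {k. e \<le> dist (X k) l}"
  have "infinite I"
    using e(2) by (auto simp: I_def eventually_sequentially infinite_nat_iff_unbounded_le not_less)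
  then have I: "strict_mono (enumerate I)" "enumerate I k \<in> I" for k
    by (auto simp: strict_mono_enumerate enumerate_in_set)
  from assms[OF I(1)] obtain s :: "nat \<Rightarrow> nat" where "(\<lambda>k. X (enumerate I (s k))) \<longlonglongrightarrow> l" by blast
  then have "eventually (\<lambda>k. dist (X (enumerate I (s k))) l < e) sequentially"
    using e(1) by (rule tendstoD)
  moreover have "\<not> dist (X (enumerate I (s k))) l < e" for k
    using I(2)[of "s k"] by (simp add: I_def)
  ultimately show False by simp
qed

text \<open>The integrand is below \<open>e / 2\<close> off the set where the deviation reaches
  \<open>e / 2\<close>, and at most 1 on it. In integral form, countably many convergences in
  measure can be summed.\<close>

lemma converges_in_measure_imp_integral_min:
  assumes "prob_space M" and conv: "converges_in_measure M u v"
    and [measurable]: "\<And>k. u k \<in> borel_measurable M" "v \<in> borel_measurable M"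
  shows "(\<lambda>k. \<integral>\<omega>. min 1 \<bar>u k \<omega> - v \<omega>\<bar> \<partial>M) \<longlonglongrightarrow> 0"
proof (rule tendstoI)
  interpret prob_space M by fact
  fix e :: real assume "0 < e"
  define S where "S k = {\<omega>\<in>space M. e / 2 \<le> \<bar>u k \<omega> - v \<omega>\<bar>}" for k
  have [measurable]: "S k \<in> sets M" for k unfolding S_def by measurable
  have "(\<lambda>k. measure M (S k)) \<longlonglongrightarrow> 0"
    unfolding S_def using \<open>0 < e\<close>
    by (intro conv[unfolded converges_in_measure_def, rule_format]) simp
  then have "eventually (\<lambda>k. measure M (S k) < e / 2) sequentially"
    by (rule order_tendstoD) (use \<open>0 < e\<close> in simp)
  then show "eventually (\<lambda>k. dist (\<integral>\<omega>. min 1 \<bar>u k \<omega> - v \<omega>\<bar> \<partial>M) 0 < e) sequentially"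
  proof eventually_elim
    case (elim k)
    have "(\<integral>\<omega>. min 1 \<bar>u k \<omega> - v \<omega>\<bar> \<partial>M) \<le> (\<integral>\<omega>. e / 2 + indicator (S k) \<omega> \<partial>M)"
    proof (rule integral_mono)
      show "integrable M (\<lambda>\<omega>. min 1 \<bar>u k \<omega> - v \<omega>\<bar>)"
        by (rule integrable_const_bound[of _ 1]) auto
      show "integrable M (\<lambda>\<omega>. e / 2 + indicator (S k) \<omega>)"
        by (intro Bochner_Integration.integrable_add integrable_const integrable_real_indicator) (auto simp: less_top[symmetric])
      show "min 1 \<bar>u k \<omega> - v \<omega>\<bar> \<le> e / 2 + indicator (S k) \<omega>" if "\<omega> \<in> space M" for \<omega>
        using that \<open>0 < e\<close> by (auto simp: S_def indicator_def min_def)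
    qed
    also have "\<dots> = e / 2 + measure M (S k)"
      by (subst Bochner_Integration.integral_add)
         (auto simp: prob_space less_top[symmetric] intro!: integrable_real_indicator)
    finally show ?case
      using elim by (simp add: integral_nonneg_AE)
  qed
qed

text \<open>Geometric weights merge the family into one sequence \<open>v k\<close> tending to 0 in
  L1. One almost everywhere convergent subsequence of it serves all members, in place of a diagonal
  argument.\<close>

lemma AE_subsequence_countable_family:
  fixes u :: "nat \<Rightarrow> nat \<Rightarrow> 'a \<Rightarrow> real"
  assumes "prob_space M" and [measurable]: "\<And>j k. u j k \<in> borel_measurable M"
    and conv: "\<And>j. (\<lambda>k. \<integral>\<omega>. min 1 \<bar>u j k \<omega>\<bar> \<partial>M) \<longlonglongrightarrow> 0"
  obtains r :: "nat \<Rightarrow> nat" where "strict_mono r" "AE \<omega> in M. \<forall>j. (\<lambda>k. u j (r k) \<omega>) \<longlonglongrightarrow> 0"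
proof -
  interpret prob_space M by fact
  define t where "t j k \<omega> = (1/2) ^ j * min 1 \<bar>u j k \<omega>\<bar>" for j k \<omega>
  have t_meas [measurable]: "t j k \<in> borel_measurable M" for j k
    unfolding t_def by measurable
  have t: "0 \<le> t j k \<omega>" "t j k \<omega> \<le> (1/2) ^ j" for j k \<omega>
    by (auto simp: t_def mult_le_one mult_left_le)
  have geo: "summable (\<lambda>j. (1/2 :: real) ^ j)" by (simp add: summable_geometric)
  have t_sum: "summable (\<lambda>j. t j k \<omega>)" for k \<omega>
    by (rule summable_comparison_test'[OF geo, of 0]) (use t in auto)
  have t_int: "integrable M (t j k)" for j k
    by (rule integrable_const_bound[of _ "(1/2) ^ j"]) (use t in auto)
  have t_int_bound: "0 \<le> (\<integral>\<omega>. t j k \<omega> \<partial>M)" "(\<integral>\<omega>. t j k \<omega> \<partial>M) \<le> (1/2) ^ j" for j k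
    using integral_mono[OF t_int integrable_const t(2)] t(1) by (auto simp: prob_space)
  define v where "v k \<omega> = (\<Sum>j. t j k \<omega>)" for k \<omega>
  have t_int_sum: "summable (\<lambda>j. \<integral>\<omega>. norm (t j k \<omega>) \<partial>M)" for k
    by (rule summable_comparison_test'[OF geo, of 0]) (use t_int_bound t in auto)
  have v_int: "integrable M (v k)" for k
    unfolding v_def using t_int t_sum t t_int_sum by (intro integrable_suminf) auto
  have v_nonneg: "0 \<le> v k \<omega>" for k \<omega>
    unfolding v_def by (intro suminf_nonneg t_sum t)
  \<comment> \<open>Tannery's theorem: each weighted integral tends to 0 and is dominated by
    \<open>(1/2) ^ j\<close>.\<close>
  have "(\<lambda>k. \<Sum>j. \<integral>\<omega>. t j k \<omega> \<partial>M) \<longlonglongrightarrow> (\<Sum>j. 0)"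
  proof (intro conjunct2[OF conjunct2[OF tannerys_theorem[where M = "\<lambda>j. (1/2) ^ j"]]])
    show "(\<lambda>k. \<integral>\<omega>. t j k \<omega> \<partial>M) \<longlonglongrightarrow> 0" for j
      using tendsto_mult_left[OF conv[of j], of "(1/2) ^ j"] by (simp add: t_def)
    show "\<forall>\<^sub>F (j, k) in at_top \<times>\<^sub>F sequentially. norm (\<integral>\<omega>. t j k \<omega> \<partial>M) \<le> (1/2) ^ j"
      using t_int_bound by (intro always_eventually) auto
  qed (use geo in auto)
  moreover have "(\<Sum>j. \<integral>\<omega>. t j k \<omega> \<partial>M) = (\<integral>\<omega>. norm (v k \<omega>) \<partial>M)" for k
    using integral_suminf[OF t_int _ t_int_sum, of k] t_sum t v_nonneg by (simp add: v_def)
  ultimately have "(\<lambda>k. \<integral>\<omega>. norm (v k \<omega>) \<partial>M) \<longlonglongrightarrow> 0" by simp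
  from tendsto_L1_AE_subseq[OF v_int this] obtain r :: "nat \<Rightarrow> nat"
    where r: "strict_mono r" "AE \<omega> in M. (\<lambda>k. v (r k) \<omega>) \<longlonglongrightarrow> 0" by blast
  have "(\<lambda>k. u j (r k) \<omega>) \<longlonglongrightarrow> 0" if v0: "(\<lambda>k. v (r k) \<omega>) \<longlonglongrightarrow> 0" for j \<omega>
  proof -
    have "t j k \<omega> \<le> v k \<omega>" for k
      unfolding v_def using sum_le_suminf[OF t_sum, of "{j}"] t by auto
    then have "min 1 \<bar>u j k \<omega>\<bar> \<le> 2 ^ j * v k \<omega>" for k
      by (simp add: t_def field_simps)
    moreover have "(\<lambda>k. 2 ^ j * v (r k) \<omega>) \<longlonglongrightarrow> 0"
      using tendsto_mult_left[OF v0, of "2 ^ j"] by simp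
    ultimately have m0: "(\<lambda>k. min 1 \<bar>u j (r k) \<omega>\<bar>) \<longlonglongrightarrow> 0"
      by (rule_tac tendsto_sandwich[where f = "\<lambda>_. 0" and h = "\<lambda>k. 2 ^ j * v (r k) \<omega>"]) auto
    \<comment> \<open>Once the minimum is below 1 it is the absolute value itself, so the truncation
      disappears.\<close>
    then have "eventually (\<lambda>k. min 1 \<bar>u j (r k) \<omega>\<bar> < 1) sequentially"
      by (rule order_tendstoD) simp
    then have "eventually (\<lambda>k. min 1 \<bar>u j (r k) \<omega>\<bar> = \<bar>u j (r k) \<omega>\<bar>) sequentially"
      by eventually_elim auto
    then have "(\<lambda>k. \<bar>u j (r k) \<omega>\<bar>) \<longlonglongrightarrow> 0"
      using m0 by (simp cong: tendsto_cong)
    then show ?thesis by (simp add: tendsto_rabs_zero_iff)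
  qed
  with r show thesis
    by (intro that[of r]) auto
qed

section \<open>The part where the functions are bounded\<close>

text \<open>Each subsequence has a further one along which the countably many functionals in
  \<open>\<Phi>\<close> tend to 0 almost everywhere. For bounded vectors in \<open>closure D\<close>
  this is weak convergence, which \<open>g \<omega>\<close> respects, and the bound \<open>L\<close>
  permits dominated convergence.\<close>

lemma truncated_integrals_tendsto_0:
  fixes h :: "nat \<Rightarrow> 'a \<Rightarrow> 'e::banach"
  assumes "prob_space M" and rnp: "radon_nikodym_property TYPE('e \<Rightarrow>\<^sub>L real)"
    and h: "\<And>k. strongly_measurable M (h k)"
    and conv: "\<And>\<phi>. converges_in_measure M (\<lambda>k \<omega>. blinfun_apply \<phi> (h k \<omega>)) (\<lambda>_. 0)"
    and g0: "\<And>\<omega>. \<omega> \<in> space M \<Longrightarrow> g \<omega> 0 = 0"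
    and g_cont: "\<And>\<omega>. \<omega> \<in> space M \<Longrightarrow> continuous_map weak_topology euclideanreal (g \<omega>)"
    and g_meas [measurable]: "\<And>k. (\<lambda>\<omega>. g \<omega> (h k \<omega>)) \<in> borel_measurable M"
    and B [measurable]: "\<And>k. B k \<in> sets M"
    and h_bound: "\<And>k \<omega>. \<omega> \<in> B k \<Longrightarrow> norm (h k \<omega>) \<le> K"
    and g_bound: "\<And>k \<omega>. \<omega> \<in> B k \<Longrightarrow> \<bar>g \<omega> (h k \<omega>)\<bar> \<le> L"
  shows "(\<lambda>k. \<integral>\<omega>. indicator (B k) \<omega> * g \<omega> (h k \<omega>) \<partial>M) \<longlonglongrightarrow> 0"
proof (rule tendsto_subsequenceI)
  fix r :: "nat \<Rightarrow> nat" assume r: "strict_mono r"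
  interpret prob_space M by fact
  have "\<exists>C. countable C \<and> h k ` space M \<subseteq> closure C" for k
    using strongly_measurable_range_separable[OF h[of k]] by blast
  then obtain C where C: "\<And>k. countable (C k)" "\<And>k. h k ` space M \<subseteq> closure (C k)"
    by metis
  \<comment> \<open>One countable set serves the whole sequence. It contains 0 for the values
    substituted off \<open>B\<close>.\<close>
  define D where "D = insert 0 (\<Union>k. C k)"
  have "countable D" using C(1) by (simp add: D_def)
  obtain \<Phi> :: "('e \<Rightarrow>\<^sub>L real) set" where \<Phi>: "countable \<Phi>"
    "\<And>\<psi> \<epsilon>. 0 < \<epsilon> \<Longrightarrow> \<exists>\<phi>\<in>\<Phi>. \<forall>x\<in>closure D. \<bar>blinfun_apply \<phi> x - blinfun_apply \<psi> x\<bar> \<le> \<epsilon> * max 1 (norm x)"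
    using rnp_dual_separable_on_closure[OF rnp \<open>countable D\<close>] by blast
  have "\<Phi> \<noteq> {}" using \<Phi>(2)[of 1 0] by auto
  define \<phi> where "\<phi> = from_nat_into \<Phi>"
  have h_meas: "(\<lambda>\<omega>. blinfun_apply \<psi> (h k \<omega>)) \<in> borel_measurable M" for \<psi> k
    by (intro strongly_measurable_continuous_compose[OF h] continuous_intros)
  obtain s :: "nat \<Rightarrow> nat" where s: "strict_mono s"
    "AE \<omega> in M. \<forall>j. (\<lambda>k. blinfun_apply (\<phi> j) (h (r (s k)) \<omega>)) \<longlonglongrightarrow> 0"
  proof (rule AE_subsequence_countable_family[of M "\<lambda>j k \<omega>. blinfun_apply (\<phi> j) (h (r k) \<omega>)"])
    fix j
    have "(\<lambda>k. \<integral>\<omega>. min 1 \<bar>blinfun_apply (\<phi> j) (h k \<omega>) - 0\<bar> \<partial>M) \<longlonglongrightarrow> 0"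
      by (rule converges_in_measure_imp_integral_min[OF \<open>prob_space M\<close> conv h_meas]) simp
    from LIMSEQ_subseq_LIMSEQ[OF this r]
    show "(\<lambda>k. \<integral>\<omega>. min 1 \<bar>blinfun_apply (\<phi> j) (h (r k) \<omega>)\<bar> \<partial>M) \<longlonglongrightarrow> 0"
      by (simp add: comp_def)
  qed (use h_meas \<open>prob_space M\<close> in auto)
  have lim: "(\<lambda>k. indicator (B (r (s k))) \<omega> * g \<omega> (h (r (s k)) \<omega>)) \<longlonglongrightarrow> 0"
    if \<omega>: "\<omega> \<in> space M" and lim: "\<forall>j. (\<lambda>k. blinfun_apply (\<phi> j) (h (r (s k)) \<omega>)) \<longlonglongrightarrow> 0" for \<omega>
  proof -
    \<comment> \<open>Substituting 0 off \<open>B\<close> keeps the sequence bounded, and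
      \<open>g \<omega> 0 = 0\<close> makes \<open>g \<omega> (x k)\<close> the truncated
      integrand.\<close>
    define x where "x k = (if \<omega> \<in> B (r (s k)) then h (r (s k)) \<omega> else 0)" for k
    have x_bound: "norm (x k) \<le> max 1 K" for k
      using h_bound[of \<omega> "r (s k)"] by (auto simp: x_def)
    have x_D: "x k \<in> closure D" for k
    proof -
      have "closure (C (r (s k))) \<subseteq> closure D" by (intro closure_mono) (auto simp: D_def)
      moreover have "0 \<in> closure D" by (rule subsetD[OF closure_subset]) (simp add: D_def)
      ultimately show ?thesis
        using C(2)[of "r (s k)"] \<omega> by (auto simp: x_def)
    qed
    have "(\<lambda>k. blinfun_apply \<psi> (x k)) \<longlonglongrightarrow> blinfun_apply \<psi> 0" for \<psi> :: "'e \<Rightarrow>\<^sub>L real"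
    proof (rule tendstoI)
      fix e :: real assume "0 < e"
      \<comment> \<open>Approximating \<open>\<psi>\<close> then costs at most \<open>e / 2\<close>
        on vectors of norm up to \<open>max 1 K\<close>; the other half is left for
        \<open>\<phi>'\<close>.\<close>
      define \<epsilon> where "\<epsilon> = e / (2 * max 1 K)"
      have \<epsilon>: "0 < \<epsilon>" "\<epsilon> * max 1 K = e / 2"
        using \<open>0 < e\<close> by (auto simp: \<epsilon>_def field_simps)
      obtain \<phi>' where \<phi>': "\<phi>' \<in> \<Phi>" "\<And>y. y \<in> closure D \<Longrightarrow> \<bar>blinfun_apply \<phi>' y - blinfun_apply \<psi> y\<bar> \<le> \<epsilon> * max 1 (norm y)"
        using \<Phi>(2)[OF \<epsilon>(1)] by blast
      obtain j where j: "\<phi> j = \<phi>'"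
        using from_nat_into_surj[OF \<Phi>(1) \<phi>'(1)] by (auto simp: \<phi>_def)
      have "(\<lambda>k. \<bar>blinfun_apply \<phi>' (h (r (s k)) \<omega>)\<bar>) \<longlonglongrightarrow> 0"
        using lim j tendsto_rabs_zero by blast
      then have "eventually (\<lambda>k. \<bar>blinfun_apply \<phi>' (h (r (s k)) \<omega>)\<bar> < e / 2) sequentially"
        by (rule order_tendstoD) (use \<open>0 < e\<close> in simp)
      then show "eventually (\<lambda>k. dist (blinfun_apply \<psi> (x k)) (blinfun_apply \<psi> 0) < e) sequentially"
      proof eventually_elim
        case (elim k)
        have "\<bar>blinfun_apply \<phi>' (x k)\<bar> < e / 2"
          using elim \<open>0 < e\<close> by (auto simp: x_def)
        moreover have "\<bar>blinfun_apply \<phi>' (x k) - blinfun_apply \<psi> (x k)\<bar> \<le> e / 2"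
          using \<phi>'(2)[OF x_D, of k] mult_left_mono[of "max 1 (norm (x k))" "max 1 K" \<epsilon>] x_bound[of k] \<epsilon>
          by linarith
        ultimately have "\<bar>blinfun_apply \<psi> (x k)\<bar> < e" by linarith
        then show ?case by (simp add: dist_real_def)
      qed
    qed
    then have "(\<lambda>k. g \<omega> (x k)) \<longlonglongrightarrow> g \<omega> 0"
      by (rule weakly_continuous_tendsto[OF g_cont[OF \<omega>]])
    moreover have "g \<omega> (x k) = indicator (B (r (s k))) \<omega> * g \<omega> (h (r (s k)) \<omega>)" for k
      using g0[OF \<omega>] by (simp add: x_def)
    ultimately show ?thesis using g0[OF \<omega>] by simp
  qed
  have AE_lim: "AE \<omega> in M. (\<lambda>k. indicator (B (r (s k))) \<omega> * g \<omega> (h (r (s k)) \<omega>)) \<longlonglongrightarrow> 0"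
    using s(2) AE_space by eventually_elim (rule lim)
  have "(\<lambda>k. \<integral>\<omega>. indicator (B (r (s k))) \<omega> * g \<omega> (h (r (s k)) \<omega>) \<partial>M) \<longlonglongrightarrow> (\<integral>\<omega>. 0 \<partial>M)"
  \<comment> \<open>The absolute value covers the points off \<open>B\<close>, where the integrand
    is 0 and \<open>g_bound\<close> gives no sign for \<open>L\<close>.\<close>
  proof (rule integral_dominated_convergence[where w = "\<lambda>_. \<bar>L\<bar>", OF _ _ _ AE_lim])
    show "AE \<omega> in M. norm (indicator (B (r (s k))) \<omega> * g \<omega> (h (r (s k)) \<omega>)) \<le> \<bar>L\<bar>" for k
      using g_bound[of _ "r (s k)"] by (intro AE_I2) (force simp: indicator_def)
  qed auto
  then show "\<exists>s. strict_mono s \<and> (\<lambda>k. \<integral>\<omega>. indicator (B (r (s k))) \<omega> * g \<omega> (h (r (s k)) \<omega>) \<partial>M) \<longlonglongrightarrow> 0"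
    using s(1) by auto
qed

section \<open>Truncation and uniform integrability\<close>

theorem theorem3p5:
  fixes M :: "'a measure"
    and f :: "nat \<Rightarrow> 'a \<Rightarrow> 'e::banach"
    and f0 :: "'a \<Rightarrow> 'e"
  assumes "prob_space M"
    and "radon_nikodym_property TYPE('e \<Rightarrow>\<^sub>L real)"
    and "\<And>k. f k \<in> bochner_L1 M"
    and "f0 \<in> bochner_L1 M"
    and "uniformly_integrable M (range f)"
    and "converges_scalarly_in_measure M f f0"
  shows "converges_limitedly M f f0"
  unfolding converges_limitedly_def
proof
  fix g :: "'a \<Rightarrow> 'e \<Rightarrow> real" assume g: "g \<in> limited_integrands M"
  interpret prob_space M by fact
  define h where "h k \<omega> = f k \<omega> - f0 \<omega>" for k \<omega>
  have h: "h k \<in> bochner_L1 M" for k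
    unfolding h_def by (intro bochner_L1_diff assms)
  from g obtain C p where g0: "\<And>\<omega>. \<omega> \<in> space M \<Longrightarrow> g \<omega> 0 = 0"
    and g_cont: "\<And>\<omega>. \<omega> \<in> space M \<Longrightarrow> continuous_map weak_topology euclideanreal (g \<omega>)"
    and C: "0 < C" and p: "integrable M p"
    and g_bound: "\<And>\<omega> x. \<omega> \<in> space M \<Longrightarrow> \<bar>g \<omega> x\<bar> \<le> C * norm x + p \<omega>"
    and g_meas: "\<And>u. u \<in> bochner_L1 M \<Longrightarrow> (\<lambda>\<omega>. g \<omega> (u \<omega>)) \<in> borel_measurable M"
    unfolding limited_integrands_def by blast
  have gh_meas [measurable]: "(\<lambda>\<omega>. g \<omega> (h k \<omega>)) \<in> borel_measurable M" for k
    by (rule g_meas[OF h])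
  have p_nonneg: "0 \<le> p \<omega>" if "\<omega> \<in> space M" for \<omega>
    using g_bound[OF that, of 0] g0[OF that] by simp
  \<comment> \<open>\<open>w\<close> collects the integrable terms that do not depend on
    \<open>k\<close>, so the tails of \<open>f0\<close> and \<open>p\<close> are treated
    together.\<close>
  define w where "w \<omega> = norm (f0 \<omega>) + p \<omega>" for \<omega>
  have w_int: "integrable M w"
    unfolding w_def by (intro Bochner_Integration.integrable_add bochner_L1_integrable_norm assms p)
  have f_int: "integrable M (\<lambda>\<omega>. norm (f k \<omega>))" for k
    by (intro bochner_L1_integrable_norm assms)
  note [measurable] = borel_measurable_integrable[OF w_int] borel_measurable_integrable[OF f_int]
  \<comment> \<open>A constant at least 1 dominates the coefficient of \<open>p\<close> as well and
    factors out of the whole bound.\<close>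
  define C' where "C' = max 1 C"
  have C': "1 \<le> C'" by (simp add: C'_def)
  have gh_bound: "\<bar>g \<omega> (h k \<omega>)\<bar> \<le> C' * (norm (f k \<omega>) + w \<omega>)" if "\<omega> \<in> space M" for k \<omega>
  proof -
    have "\<bar>g \<omega> (h k \<omega>)\<bar> \<le> C * norm (h k \<omega>) + p \<omega>"
      by (rule g_bound[OF that])
    also have "\<dots> \<le> C' * norm (h k \<omega>) + C' * p \<omega>"
      using mult_right_mono[OF C' p_nonneg[OF that]] by (intro add_mono mult_right_mono) (auto simp: C'_def)
    also have "\<dots> \<le> C' * (norm (f k \<omega>) + norm (f0 \<omega>)) + C' * p \<omega>"
      using C' by (intro add_mono mult_left_mono) (auto simp: h_def norm_triangle_ineq4)
    finally show ?thesis by (simp add: w_def algebra_simps)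
  qed
  have gh_int: "integrable M (\<lambda>\<omega>. g \<omega> (h k \<omega>))" for k
  proof (rule Bochner_Integration.integrable_bound)
    show "integrable M (\<lambda>\<omega>. C' * (norm (f k \<omega>) + w \<omega>))"
      using f_int w_int by auto
    show "AE \<omega> in M. norm (g \<omega> (h k \<omega>)) \<le> norm (C' * (norm (f k \<omega>) + w \<omega>))"
      using order_trans[OF gh_bound abs_ge_self] by (intro AE_I2) simp
  qed measurable
  have h_conv: "converges_in_measure M (\<lambda>k \<omega>. blinfun_apply \<phi> (h k \<omega>)) (\<lambda>_. 0)" for \<phi>
    using assms(6) by (simp add: converges_scalarly_in_measure_def converges_in_measure_def h_def blinfun.diff_right)

  have "(\<lambda>k. \<integral>\<omega>. g \<omega> (h k \<omega>) \<partial>M) \<longlonglongrightarrow> 0"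
  proof (rule tendstoI)
    fix e :: real assume "0 < e"
    \<comment> \<open>The tails of \<open>f k\<close> and \<open>w\<close> will each be at most
      \<open>\<eta>\<close> and enter with the factor \<open>2 * C'\<close>, using up half of
      \<open>e\<close>.\<close>
    define \<eta> where "\<eta> = e / (8 * C')"
    have \<eta>: "0 < \<eta>" "2 * C' * (\<eta> + \<eta>) = e / 2"
      using \<open>0 < e\<close> C' by (auto simp: \<eta>_def field_simps)
    \<comment> \<open>Dominated convergence makes the tails of the single function \<open>w\<close>
      small. Natural thresholds give a sequence, and the same \<open>c\<close> then serves the
      uniform integrability bound.\<close>
    have "(\<lambda>c. \<integral>\<omega>. indicator {\<omega>\<in>space M. real c \<le> w \<omega>} \<omega> * w \<omega> \<partial>M) \<longlonglongrightarrow> (\<integral>\<omega>. 0 \<partial>M)"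
    proof (rule integral_dominated_convergence[where w = "\<lambda>\<omega>. norm (w \<omega>)"])
      show "AE \<omega> in M. (\<lambda>c. indicator {\<omega>\<in>space M. real c \<le> w \<omega>} \<omega> * w \<omega>) \<longlonglongrightarrow> 0"
      proof (rule AE_I2)
        fix \<omega>
        obtain c0 :: nat where "w \<omega> < real c0" using reals_Archimedean2 by blast
        then have "eventually (\<lambda>c. indicator {\<omega>\<in>space M. real c \<le> w \<omega>} \<omega> * w \<omega> = 0) sequentially"
          by (intro eventually_sequentiallyI[of c0]) (auto simp: indicator_def)
        then show "(\<lambda>c. indicator {\<omega>\<in>space M. real c \<le> w \<omega>} \<omega> * w \<omega>) \<longlonglongrightarrow> 0"
          by (rule tendsto_eventually)
      qed
    qed (use w_int in \<open>auto simp: indicator_def\<close>)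
    then have "eventually (\<lambda>c. (\<integral>\<omega>. indicator {\<omega>\<in>space M. real c \<le> w \<omega>} \<omega> * w \<omega> \<partial>M) < \<eta>) sequentially"
      using \<eta>(1) by (intro order_tendstoD(2)) simp_all
    moreover have "eventually (\<lambda>c. (SUP u\<in>range f. \<integral>\<^sup>+\<omega>\<in>{\<omega>\<in>space M. real c \<le> norm (u \<omega>)}. ennreal (norm (u \<omega>)) \<partial>M) < ennreal \<eta>) sequentially"
      using assms(5) \<eta>(1) unfolding uniformly_integrable_def
      by (intro order_tendstoD(2)[OF filterlim_compose[OF _ filterlim_real_sequentially]]) auto
    ultimately obtain c :: nat where
      cw: "(\<integral>\<omega>. indicator {\<omega>\<in>space M. real c \<le> w \<omega>} \<omega> * w \<omega> \<partial>M) < \<eta>" and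
      cf: "(SUP u\<in>range f. \<integral>\<^sup>+\<omega>\<in>{\<omega>\<in>space M. real c \<le> norm (u \<omega>)}. ennreal (norm (u \<omega>)) \<partial>M) < ennreal \<eta>"
      using eventually_happens'[OF sequentially_bot eventually_conj] by blast
    have cf: "(\<integral>\<omega>. indicator {\<omega>\<in>space M. real c \<le> norm (f k \<omega>)} \<omega> * norm (f k \<omega>) \<partial>M) \<le> \<eta>" for k
    proof (rule integral_real_bounded)
      have "(\<integral>\<^sup>+\<omega>\<in>{\<omega>\<in>space M. real c \<le> norm (f k \<omega>)}. ennreal (norm (f k \<omega>)) \<partial>M) \<le> ennreal \<eta>"
        using cf by (intro less_imp_le[OF le_less_trans[OF SUP_upper cf]]) auto
      then show "(\<integral>\<^sup>+\<omega>. ennreal (indicator {\<omega>\<in>space M. real c \<le> norm (f k \<omega>)} \<omega> * norm (f k \<omega>)) \<partial>M) \<le> ennreal \<eta>"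
        by (simp add: ennreal_mult' ennreal_indicator mult.commute)
    qed (use \<eta>(1) in simp)
    \<comment> \<open>On \<open>B k\<close> both summands of the bound are at most \<open>c\<close>.
      As \<open>p\<close> is nonnegative, \<open>w\<close> bounds the norm of \<open>f0\<close>, so
      \<open>h k\<close> is bounded there too.\<close>
    define B where "B k = {\<omega>\<in>space M. norm (f k \<omega>) \<le> real c \<and> w \<omega> \<le> real c}" for k
    have [measurable]: "B k \<in> sets M" for k
      unfolding B_def by measurable
    have "(\<lambda>k. \<integral>\<omega>. indicator (B k) \<omega> * g \<omega> (h k \<omega>) \<partial>M) \<longlonglongrightarrow> 0"
    proof (rule truncated_integrals_tendsto_0[OF assms(1,2) bochner_L1_strongly_measurable[OF h] h_conv g0 g_cont gh_meas])
      show "norm (h k \<omega>) \<le> 2 * real c" if "\<omega> \<in> B k" for k \<omega>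
        using that norm_triangle_ineq4[of "f k \<omega>" "f0 \<omega>"] p_nonneg[of \<omega>] by (auto simp: B_def w_def h_def)
      show "\<bar>g \<omega> (h k \<omega>)\<bar> \<le> C' * (2 * real c)" if "\<omega> \<in> B k" for k \<omega>
      proof -
        have "C' * (norm (f k \<omega>) + w \<omega>) \<le> C' * (2 * real c)"
          using that C' by (intro mult_left_mono) (auto simp: B_def)
        then show ?thesis
          using gh_bound[of \<omega> k] that by (auto simp: B_def)
      qed
    qed measurable
    then have "eventually (\<lambda>k. dist (\<integral>\<omega>. indicator (B k) \<omega> * g \<omega> (h k \<omega>) \<partial>M) 0 < e / 2) sequentially"
      by (rule tendstoD) (use \<open>0 < e\<close> in simp)
    then show "eventually (\<lambda>k. dist (\<integral>\<omega>. g \<omega> (h k \<omega>) \<partial>M) 0 < e) sequentially"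
    proof eventually_elim
      case (elim k)
      have B_int: "integrable M (\<lambda>\<omega>. indicator (B k) \<omega> * g \<omega> (h k \<omega>))"
        using integrable_mult_indicator[OF _ gh_int] by simp
      have tail_int: "integrable M (\<lambda>\<omega>. indicator {\<omega>\<in>space M. real c \<le> u \<omega>} \<omega> * u \<omega>)"
        if [measurable]: "integrable M u" for u :: "'a \<Rightarrow> real"
        using integrable_mult_indicator[OF _ that, of "{\<omega>\<in>space M. real c \<le> u \<omega>}"] by simp
      \<comment> \<open>Truncation changes the integral only off \<open>B k\<close>, and the change
        is controlled by tails beyond \<open>c\<close> that are small uniformly in
        \<open>k\<close>.\<close>
      have "\<bar>(\<integral>\<omega>. g \<omega> (h k \<omega>) \<partial>M) - (\<integral>\<omega>. indicator (B k) \<omega> * g \<omega> (h k \<omega>) \<partial>M)\<bar>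
          = \<bar>\<integral>\<omega>. g \<omega> (h k \<omega>) - indicator (B k) \<omega> * g \<omega> (h k \<omega>) \<partial>M\<bar>"
        by (simp add: gh_int B_int)
      also have "\<dots> \<le> (\<integral>\<omega>. \<bar>g \<omega> (h k \<omega>) - indicator (B k) \<omega> * g \<omega> (h k \<omega>)\<bar> \<partial>M)"
        by (rule integral_abs_bound)
      also have "\<dots> \<le> (\<integral>\<omega>. 2 * C' * (indicator {\<omega>\<in>space M. real c \<le> norm (f k \<omega>)} \<omega> * norm (f k \<omega>)
          + indicator {\<omega>\<in>space M. real c \<le> w \<omega>} \<omega> * w \<omega>) \<partial>M)"
      proof (rule integral_mono)
        fix \<omega> assume \<omega>: "\<omega> \<in> space M"
        have w0: "0 \<le> w \<omega>" using p_nonneg[OF \<omega>] by (simp add: w_def)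
        show "\<bar>g \<omega> (h k \<omega>) - indicator (B k) \<omega> * g \<omega> (h k \<omega>)\<bar>
          \<le> 2 * C' * (indicator {\<omega>\<in>space M. real c \<le> norm (f k \<omega>)} \<omega> * norm (f k \<omega>)
            + indicator {\<omega>\<in>space M. real c \<le> w \<omega>} \<omega> * w \<omega>)"
        proof (cases "\<omega> \<in> B k")
          case True
          then show ?thesis using C' w0 by simp
        next
          case False
          \<comment> \<open>Off \<open>B k\<close> the larger of the two summands exceeds \<open>c\<close> and dominates the other.\<close>
          then have "norm (f k \<omega>) + w \<omega>
            \<le> 2 * (indicator {\<omega>\<in>space M. real c \<le> norm (f k \<omega>)} \<omega> * norm (f k \<omega>)
              + indicator {\<omega>\<in>space M. real c \<le> w \<omega>} \<omega> * w \<omega>)"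
            using \<omega> w0 by (auto simp: B_def indicator_def)
          from order_trans[OF gh_bound[OF \<omega>, of k] mult_left_mono[OF this, of C']] C' show ?thesis
            using False by (simp add: algebra_simps)
        qed
      next
        show "integrable M (\<lambda>\<omega>. 2 * C' * (indicator {\<omega>\<in>space M. real c \<le> norm (f k \<omega>)} \<omega> * norm (f k \<omega>)
          + indicator {\<omega>\<in>space M. real c \<le> w \<omega>} \<omega> * w \<omega>))"
          by (intro integrable_mult_right Bochner_Integration.integrable_add tail_int f_int w_int)
      qed (intro integrable_abs Bochner_Integration.integrable_diff gh_int B_int)
      also have "\<dots> = 2 * C' * ((\<integral>\<omega>. indicator {\<omega>\<in>space M. real c \<le> norm (f k \<omega>)} \<omega> * norm (f k \<omega>) \<partial>M)
          + (\<integral>\<omega>. indicator {\<omega>\<in>space M. real c \<le> w \<omega>} \<omega> * w \<omega> \<partial>M))"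
        by (simp only: integral_mult_right_zero Bochner_Integration.integral_add[OF tail_int[OF f_int] tail_int[OF w_int]])
      also have "\<dots> \<le> 2 * C' * (\<eta> + \<eta>)"
        using cf[of k] cw C' by (intro mult_left_mono add_mono) auto
      finally show ?case
        using elim \<eta>(2) by (simp add: dist_real_def)
    qed
  qed
  then show "(\<lambda>k. \<integral>\<omega>. g \<omega> (f k \<omega> - f0 \<omega>) \<partial>M) \<longlonglongrightarrow> 0"
    by (simp add: h_def)
qed

end
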